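(* If $\mathcal W_{\mathbf M}^{\psi}[f](b,a)$ is the special affine wavelet transform of an arbitrary function $f\in L^2(\mathbb R)$, then $f$ can be reconstructed as $$f(t)=\frac1{C_\psi}\int_{\mathbb R}\int_{\mathbb R^+}\mathcal W_{\mathbf M}^{\psi}[f](b,a)\,\psi^{\mathbf M}_{b,a}(t)\,\frac{db\,da}{a^2},\quad\text{a.e.},$$ where $C_\psi$ is given by the admissibility condition $$C_\psi=\int_{\mathbb R^+}\frac{1}{a}\left|\mathrm S_{\mathbf M}\left[\exp\left\{\frac{i}{2B}\left(2zp(a-1)-Az^2\right)\right\}\overline{\psi(-z)}\right](a\omega)\right|^2da<\infty\quad\text{a.e. }\omega\in\mathbb R.$$
   Context: Fix real parameters $A,B,C,D,p,q$ with $AD-BC=1$ and $B\neq0$, and write $\mathbf M=(A,B,C,D:p,q)$; $\mathbb R^+=(0,\infty)$. The special affine Fourier transform (SAFT) is $\mathrm S_{\mathbf M}[f](\omega)=\int_{\mathbb R}f(t)\,\mathcal K_{\mathbf M}(t,\omega)\,dt$ with $$\mathcal K_{\mathbf M}(t,\omega)=\frac{1}{\sqrt{i2\pi B}}\exp\left\{\frac{i}{2B}\left(At^2+2t(p-\omega)-2\omega(Dp-Bq)+D(\omega^2+p^2)\right)\right\},$$ understood on $L^2(\mathbb R)$ in the usual Plancherel sense. In the formula for $C_\psi$ the SAFT is taken in the variable $z$ with $a$ fixed, and evaluated at $a\omega$. For a wavelet $\psi\in L^2(\mathbb R)$, $b\in\mathbb R$, $a\in\mathbb R^+$ put $$\psi^{\mathbf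 M}_{b,a}(t)=\frac{1}{\sqrt{i2\pi aB}}\,\psi\left(\frac{t-b}{a}\right)\exp\left\{-\frac{i}{2B}\left(At^2+Dp^2-A\left(\frac ba\right)^2\right)\right\}.$$ The special affine wavelet transform of $f\in L^2(\mathbb R)$ with respect to $\psi$ is $\mathcal W_{\mathbf M}^{\psi}[f](b,a)=\int_{\mathbb R}f(t)\,\overline{\psi^{\mathbf M}_{b,a}(t)}\,dt$.
   Formalization: The double integral, which need not converge absolutely at a.e. t, is taken as the L²-limit of integrals over regions with a bounded away from 0; the literal formula is given for a.e. t where it converges absolutely. C_ψ is assumed nonzero and the same constant for a.e. ω. *)

theory Defs
  imports "HOL-Analysis.Analysis"
begin

text \<open>The parameter tuple \<open>M = (A, B, C, D : p, q)\<close>.\<close>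

type_synonym saft_params = "real \<times> real \<times> real \<times> real \<times> real \<times> real"

text \<open>Membership in \<open>L\<^sup>2(\<real>)\<close>; elements are Borel representatives, and two of them denote the
  same element when they agree a.e.\<close>

definition L2 :: "(real \<Rightarrow> complex) \<Rightarrow> bool" where
  "L2 f \<longleftrightarrow> f \<in> borel_measurable lborel \<and> integrable lborel (\<lambda>t. (norm (f t))\<^sup>2)"

definition tendsto_L2 :: "(nat \<Rightarrow> real \<Rightarrow> complex) \<Rightarrow> (real \<Rightarrow> complex) \<Rightarrow> bool" where
  "tendsto_L2 g h \<longleftrightarrow>
     (\<forall>n. g n \<in> borel_measurable lborel) \<and> h \<in> borel_measurable lborel \<and>
     (\<lambda>n. \<integral>\<^sup>+ t. ennreal ((norm (g n t - h t))\<^sup>2) \<partial>lborel) \<longlonglongrightarrow> 0"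

text \<open>The square root is the principal branch.\<close>

fun SAFT_kernel :: "saft_params \<Rightarrow> real \<Rightarrow> real \<Rightarrow> complex" where
  "SAFT_kernel (A, B, C, D, p, q) t \<omega> =
     1 / csqrt (\<i> * of_real (2 * pi * B)) *
     exp (\<i> / of_real (2 * B) *
       of_real (A * t\<^sup>2 + 2 * t * (p - \<omega>) - 2 * \<omega> * (D * p - B * q) + D * (\<omega>\<^sup>2 + p\<^sup>2)))"

text \<open>\<open>F\<close> is (a representative of) the SAFT of \<open>f \<in> L\<^sup>2(\<real>)\<close> in the Plancherel sense: the
  \<open>L\<^sup>2\<close>-limit of the SAFTs of the truncations of \<open>f\<close> to \<open>[-n, n]\<close>, whose integrals
  converge absolutely. It is a relation because \<open>F\<close> is only determined a.e.\<close>

definition is_SAFT :: "saft_params \<Rightarrow> (real \<Rightarrow> complex) \<Rightarrow> (real \<Rightarrow> complex) \<Rightarrow> bool" where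
  "is_SAFT M f F \<longleftrightarrow> L2 f \<and> L2 F \<and>
     tendsto_L2 (\<lambda>n \<omega>. LINT t:{- real n..real n}|lborel. f t * SAFT_kernel M t \<omega>) F"

fun SA_wavelet :: "saft_params \<Rightarrow> (real \<Rightarrow> complex) \<Rightarrow> real \<Rightarrow> real \<Rightarrow> real \<Rightarrow> complex" where
  "SA_wavelet (A, B, C, D, p, q) \<psi> b a t =
     1 / csqrt (\<i> * of_real (2 * pi * a * B)) * \<psi> ((t - b) / a) *
     exp (- (\<i> / of_real (2 * B)) * of_real (A * t\<^sup>2 + D * p\<^sup>2 - A * (b / a)\<^sup>2))"

definition SAWT ::
  "saft_params \<Rightarrow> (real \<Rightarrow> complex) \<Rightarrow> (real \<Rightarrow> complex) \<Rightarrow> real \<Rightarrow> real \<Rightarrow> complex" where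
  "SAWT M \<psi> f b a = (LINT t|lborel. f t * cnj (SA_wavelet M \<psi> b a t))"

text \<open>The function of \<open>z\<close> (with \<open>a\<close> fixed) whose SAFT occurs in the admissibility condition.\<close>

fun adm_function :: "saft_params \<Rightarrow> (real \<Rightarrow> complex) \<Rightarrow> real \<Rightarrow> real \<Rightarrow> complex" where
  "adm_function (A, B, C, D, p, q) \<psi> a z =
     exp (\<i> / of_real (2 * B) * of_real (2 * z * p * (a - 1) - A * z\<^sup>2)) * cnj (\<psi> (- z))"

text \<open>\<open>c\<close> is the finite constant \<open>C\<^sub>\<psi>\<close>: for a.e. \<open>\<omega>\<close> the admissibility integral equals \<open>c\<close>.
  For each \<open>a\<close> the SAFT is only determined a.e., so the integral over \<open>a\<close> at a fixed \<open>\<omega>\<close> is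
  meaningful only for a jointly measurable choice \<open>S a \<omega>\<close> of representatives. By Fubini, two such
  choices give the same integral for a.e. \<open>\<omega>\<close>, so the condition does not depend on \<open>S\<close>.\<close>

definition admissibility_constant :: "saft_params \<Rightarrow> (real \<Rightarrow> complex) \<Rightarrow> real \<Rightarrow> bool" where
  "admissibility_constant M \<psi> c \<longleftrightarrow> 0 \<le> c \<and>
     (\<exists>S. case_prod S \<in> borel_measurable (lborel \<Otimes>\<^sub>M lborel) \<and>
          (\<forall>a>0. is_SAFT M (adm_function M \<psi> a) (S a)) \<and>
          (AE \<omega> in lborel.
             (\<integral>\<^sup>+ a\<in>{0<..}. ennreal (1 / a * (norm (S a (a * \<omega>)))\<^sup>2) \<partial>lborel) = ennreal c))"

text \<open>Translation comes first and scale second: \<open>(b, a) \<in> \<real> \<times> \<real>\<^sup>+\<close>.\<close>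

definition half_plane :: "(real \<times> real) set" where
  "half_plane = UNIV \<times> {0<..}"

definition half_plane_exhaustion :: "(nat \<Rightarrow> (real \<times> real) set) \<Rightarrow> bool" where
  "half_plane_exhaustion E \<longleftrightarrow>
     incseq E \<and> (\<forall>n. E n \<in> sets borel) \<and> (\<Union>n. E n) = half_plane \<and>
     (\<forall>n. \<exists>\<delta>>0. E n \<subseteq> UNIV \<times> {\<delta>..})"

text \<open>\<open>I \<in> L\<^sup>2(\<real>)\<close> is the double integral of \<open>\<Phi> b a t\<close> with respect to \<open>db da / a\<^sup>2\<close>, as
  an integral of functions of \<open>t\<close>. For the reconstruction integrand of a general
  \<open>f \<in> L\<^sup>2(\<real>)\<close> the integral at a fixed \<open>t\<close> need not converge absolutely as \<open>a\<close> tends to \<open>0\<close>,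
  so it is taken, like the Plancherel integral, as an \<open>L\<^sup>2\<close>-limit: on every region on which \<open>a\<close>
  is bounded away from \<open>0\<close> it is an ordinary Lebesgue integral for each \<open>t\<close>, and these
  integrals tend to \<open>I\<close> in \<open>L\<^sup>2\<close> along every exhaustion of the half plane by such regions.\<close>

definition has_half_plane_integral_L2 ::
  "(real \<Rightarrow> real \<Rightarrow> real \<Rightarrow> complex) \<Rightarrow> (real \<Rightarrow> complex) \<Rightarrow> bool" where
  "has_half_plane_integral_L2 \<Phi> I \<longleftrightarrow> L2 I \<and>
     (\<forall>E. half_plane_exhaustion E \<longrightarrow>
        (\<forall>n t. set_integrable lborel (E n) (\<lambda>(b, a). \<Phi> b a t / of_real (a\<^sup>2))) \<and>
        tendsto_L2 (\<lambda>n t. LINT (b, a):E n|lborel. \<Phi> b a t / of_real (a\<^sup>2)) I)"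

end

theory Submission
  imports Defs "HOL-Probability.Characteristic_Functions"
begin

text \<open>
  Everything rests on the identity
  \<open>\<integral>\<integral> |W f (b, a)|\<^sup>2 db da / a\<^sup>2 = C\<^sub>\<psi> \<parallel>f\<parallel>\<^sup>2\<close>, which says that the wavelets form a continuous tight
  frame (\<open>SAWT_isometry\<close>).

  The chirps are harmless here: with \<open>g t = f t exp (i A t\<^sup>2 / (2 B))\<close>, the modulus of \<open>W f (b, a)\<close> is
  \<open>1 / sqrt (2\<pi> a |B|)\<close> times that of the correlation of \<open>g\<close> with the dilated wavelet \<open>\<psi> (t / a)\<close>
  (\<open>SAWT_norm\<close>). Plancherel's theorem in \<open>b\<close> computes the energy at the scale \<open>a\<close> from
  \<open>|\<gamma> \<xi>|\<^sup>2 |\<Psi> (a \<xi>)|\<^sup>2\<close>, where \<open>\<gamma>\<close> and \<open>\<Psi>\<close> are the Fourier transforms of \<open>g\<close> and \<open>\<psi>\<close>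
  (\<open>correlation_Plancherel\<close>). The parameters in the admissibility condition are arranged so that its
  SAFT, at \<open>a (p + B \<xi>)\<close>, has modulus \<open>|\<Psi> (a \<xi>)| / sqrt (2\<pi> |B|)\<close> (\<open>weak_fourier_of_SAFT\<close>); the
  integral over \<open>a\<close> is therefore the admissibility integral, the constant \<open>C\<^sub>\<psi>\<close>, and what is left is the
  energy of \<open>g\<close>. The transform \<open>\<Psi>\<close> of the merely square integrable \<open>\<psi>\<close> is supplied, for each \<open>a\<close>, by
  the SAFT in the admissibility condition, while \<open>g\<close> may be taken in \<open>L\<^sup>1 \<inter> L\<^sup>2\<close>. There Plancherel's
  theorem (\<open>Plancherel\<close>) follows by testing \<open>|\<gamma>|\<^sup>2\<close> against widening Gaussians, using the continuity of
  translations in \<open>L\<^sup>2\<close>.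

  Reconstruction holds for every tight frame with bound \<open>C\<close>. Let \<open>J\<close> be the synthesis integral over a
  part \<open>E\<close> of the index set. Polarizing the isometry, \<open>C f - J\<close> is tested against \<open>h\<close> by
  pairing the coefficients of \<open>f\<close> and \<open>h\<close> outside \<open>E\<close>, so that
  \<open>\<parallel>C f - J\<parallel>\<^sup>2 \<le> C \<integral> |W f|\<^sup>2\<close> with the integral taken over the complement of \<open>E\<close>
  (\<open>partial_synthesis_error\<close>). This tends to \<open>0\<close> along any exhaustion. On regions where \<open>a\<close> is bounded
  away from \<open>0\<close> the wavelets have uniformly bounded energy at each point \<open>t\<close>
  (\<open>SA_frame_energy_away_from_zero\<close>), so the synthesis integral converges absolutely there. Where the
  integral over the whole half plane converges absolutely, it is a pointwise limit of the partial
  ones, and pointwise and \<open>L\<^sup>2\<close> limits agree almost everywhere.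
\<close>

section \<open>Square integrable functions\<close>

text \<open>The measure is a parameter because both sides of the wavelet transform are measured in
  \<open>L\<^sup>2\<close>: functions on the line and their coefficients on the half plane.\<close>

definition square_integrable :: "'a measure \<Rightarrow> ('a \<Rightarrow> complex) \<Rightarrow> bool" where
  "square_integrable M f \<longleftrightarrow> f \<in> borel_measurable M \<and> integrable M (\<lambda>x. (norm (f x))\<^sup>2)"

lemma L2_iff_square_integrable: "L2 f \<longleftrightarrow> square_integrable lborel f"
  by (simp add: L2_def square_integrable_def)

lemma square_integrable_measurable [measurable_dest]:
  "square_integrable M f \<Longrightarrow> f \<in> borel_measurable M"
  by (simp add: square_integrable_def)

lemma square_integrable_integrable:
  "square_integrable M f \<Longrightarrow> integrable M (\<lambda>x. (norm (f x))\<^sup>2)"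
  by (simp add: square_integrable_def)

lemma square_integrable_iff_finite:
  "square_integrable M f \<longleftrightarrow>
     f \<in> borel_measurable M \<and> (\<integral>\<^sup>+x. ennreal ((norm (f x))\<^sup>2) \<partial>M) < \<infinity>"
  unfolding square_integrable_def integrable_iff_bounded by auto

lemma nn_integral_square:
  "square_integrable M f \<Longrightarrow>
     (\<integral>\<^sup>+x. ennreal ((norm (f x))\<^sup>2) \<partial>M) = ennreal (LINT x|M. (norm (f x))\<^sup>2)"
  unfolding square_integrable_def by (intro nn_integral_eq_integral) auto

lemma borel_measurable_cnj [measurable (raw)]:
  "f \<in> borel_measurable M \<Longrightarrow> (\<lambda>x. cnj (f x)) \<in> borel_measurable M"
  by (simp add: borel_measurable_complex_iff)

lemma square_integrable_bound:
  assumes "square_integrable M u" "v \<in> borel_measurable M"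
    and "\<And>x. x \<in> space M \<Longrightarrow> norm (v x) \<le> K * norm (u x)"
  shows "square_integrable M v"
proof -
  note [measurable] = assms(2)
  have "integrable M (\<lambda>x. (norm (v x))\<^sup>2)"
  proof (rule Bochner_Integration.integrable_bound)
    show "integrable M (\<lambda>x. K\<^sup>2 * (norm (u x))\<^sup>2)"
      using assms(1) by (simp add: square_integrable_def)
    have "norm ((norm (v x))\<^sup>2) \<le> norm (K\<^sup>2 * (norm (u x))\<^sup>2)" if "x \<in> space M" for x
      using power_mono[OF assms(3)[OF that] norm_ge_zero, of 2] by (simp add: power_mult_distrib)
    then show "AE x in M. norm ((norm (v x))\<^sup>2) \<le> norm (K\<^sup>2 * (norm (u x))\<^sup>2)"
      by (rule AE_I2)
  qed measurable
  then show ?thesis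
    using assms(2) by (simp add: square_integrable_def)
qed

lemma square_integrable_cmult:
  "square_integrable M u \<Longrightarrow> square_integrable M (\<lambda>x. c * u x)"
  by (rule square_integrable_bound[of M u _ "norm c"])
     (simp_all add: norm_mult square_integrable_measurable borel_measurable_times)

lemma square_integrable_cnj:
  "square_integrable M u \<Longrightarrow> square_integrable M (\<lambda>x. cnj (u x))"
  by (rule square_integrable_bound[of M u _ 1])
     (simp_all add: borel_measurable_cnj square_integrable_measurable)

lemma square_integrable_add:
  assumes "square_integrable M u" "square_integrable M v"
  shows "square_integrable M (\<lambda>x. u x + v x)"
proof -
  note [measurable] = assms[THEN square_integrable_measurable]
  have int: "integrable M (\<lambda>x. 2 * (norm (u x))\<^sup>2 + 2 * (norm (v x))\<^sup>2)"
    using assms by (simp add: square_integrable_def)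
  have le: "norm ((norm (u x + v x))\<^sup>2) \<le> norm (2 * (norm (u x))\<^sup>2 + 2 * (norm (v x))\<^sup>2)" for x
  proof -
    have "(norm (u x + v x))\<^sup>2 \<le> (norm (u x) + norm (v x))\<^sup>2"
      by (intro power_mono norm_triangle_ineq) auto
    also have "\<dots> \<le> 2 * (norm (u x))\<^sup>2 + 2 * (norm (v x))\<^sup>2"
      using sum_squares_bound[of "norm (u x)" "norm (v x)"] by (simp add: power2_sum)
    finally show ?thesis by simp
  qed
  have "integrable M (\<lambda>x. (norm (u x + v x))\<^sup>2)"
    by (rule Bochner_Integration.integrable_bound[OF int _ AE_I2[OF le]]) measurable
  then show ?thesis
    by (simp add: square_integrable_def)
qed

lemma square_integrable_diff:
  assumes "square_integrable M u" "square_integrable M v"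
  shows "square_integrable M (\<lambda>x. u x - v x)"
  using square_integrable_add[OF assms(1) square_integrable_cmult[OF assms(2), of "-1"]] by simp

lemma square_integrable_mult_integrable:
  assumes "square_integrable M u" "square_integrable M v"
  shows "integrable M (\<lambda>x. u x * v x)"
proof (rule Bochner_Integration.integrable_bound)
  show "integrable M (\<lambda>x. (norm (u x))\<^sup>2 + (norm (v x))\<^sup>2)"
    using assms by (simp add: square_integrable_def)
  show "(\<lambda>x. u x * v x) \<in> borel_measurable M"
    using assms by (simp add: square_integrable_measurable borel_measurable_times)
  have "norm (u x) * norm (v x) \<le> (norm (u x))\<^sup>2 + (norm (v x))\<^sup>2" for x
    using sum_squares_bound[of "norm (u x)" "norm (v x)"]
      mult_nonneg_nonneg[of "norm (u x)" "norm (v x)", OF norm_ge_zero norm_ge_zero] by linarith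
  then show "AE x in M. norm (u x * v x) \<le> norm ((norm (u x))\<^sup>2 + (norm (v x))\<^sup>2)"
    by (simp add: norm_mult)
qed

lemma square_integrable_Cauchy_Schwarz:
  assumes u: "square_integrable M u" and v: "square_integrable M v"
  shows "(LINT x|M. norm (u x * v x))\<^sup>2
           \<le> (LINT x|M. (norm (u x))\<^sup>2) * (LINT x|M. (norm (v x))\<^sup>2)"
proof -
  note [measurable] = square_integrable_measurable[OF u] square_integrable_measurable[OF v]
  have "(\<integral>\<^sup>+x. ennreal (norm (u x)) * ennreal (norm (v x)) \<partial>M)\<^sup>2
      \<le> (\<integral>\<^sup>+x. (ennreal (norm (u x)))\<^sup>2 \<partial>M) * (\<integral>\<^sup>+x. (ennreal (norm (v x)))\<^sup>2 \<partial>M)"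
    by (rule Cauchy_Schwarz_nn_integral) auto
  also have "(\<integral>\<^sup>+x. ennreal (norm (u x)) * ennreal (norm (v x)) \<partial>M)
      = ennreal (LINT x|M. norm (u x * v x))"
    using integrable_norm[OF square_integrable_mult_integrable[OF u v]]
    by (subst nn_integral_eq_integral[symmetric]) (auto simp: norm_mult ennreal_mult)
  also have "(\<integral>\<^sup>+x. (ennreal (norm (u x)))\<^sup>2 \<partial>M) = ennreal (LINT x|M. (norm (u x))\<^sup>2)"
    using nn_integral_square[OF u] by (simp add: ennreal_power)
  also have "(\<integral>\<^sup>+x. (ennreal (norm (v x)))\<^sup>2 \<partial>M) = ennreal (LINT x|M. (norm (v x))\<^sup>2)"
    using nn_integral_square[OF v] by (simp add: ennreal_power)
  finally show ?thesis
    by (simp add: ennreal_power flip: ennreal_mult)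
qed

lemma square_integrable_Cauchy_Schwarz_inner:
  assumes u: "square_integrable M u" and v: "square_integrable M v"
  shows "(norm (LINT x|M. u x * v x))\<^sup>2
           \<le> (LINT x|M. (norm (u x))\<^sup>2) * (LINT x|M. (norm (v x))\<^sup>2)"
  by (rule order_trans[OF power_mono[OF integral_norm_bound norm_ge_zero]
        square_integrable_Cauchy_Schwarz[OF u v]])

text \<open>Inner products are continuous in \<open>L\<^sup>2\<close>: Cauchy-Schwarz bounds the error by
  \<open>\<parallel>un n - u\<parallel> \<parallel>v\<parallel>\<close>.\<close>

lemma square_integrable_inner_tendsto:
  assumes u: "square_integrable M u" and un: "\<And>n. square_integrable M (un n)"
    and lim: "(\<lambda>n. LINT x|M. (norm (un n x - u x))\<^sup>2) \<longlonglongrightarrow> 0"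
    and v: "square_integrable M v"
  shows "(\<lambda>n. LINT x|M. un n x * v x) \<longlonglongrightarrow> (LINT x|M. u x * v x)"
proof -
  have le: "norm ((norm ((LINT x|M. un n x * v x) - (LINT x|M. u x * v x)))\<^sup>2)
      \<le> (LINT x|M. (norm (un n x - u x))\<^sup>2) * (LINT x|M. (norm (v x))\<^sup>2)" for n
    using square_integrable_Cauchy_Schwarz_inner[OF square_integrable_diff[OF un u] v, of n]
    by (simp add: left_diff_distrib Bochner_Integration.integral_diff
        square_integrable_mult_integrable[OF un v] square_integrable_mult_integrable[OF u v])
  have "(\<lambda>n. (norm ((LINT x|M. un n x * v x) - (LINT x|M. u x * v x)))\<^sup>2) \<longlonglongrightarrow> 0"
    by (rule Lim_null_comparison[OF always_eventually[OF allI[OF le]] tendsto_mult_left_zero[OF lim]])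
  then have "(\<lambda>n. norm ((LINT x|M. un n x * v x) - (LINT x|M. u x * v x))) \<longlonglongrightarrow> 0"
    using tendsto_real_sqrt by fastforce
  then show ?thesis
    by (simp add: tendsto_norm_zero_iff LIM_zero_iff)
qed

lemma polarization:
  fixes u v :: complex
  shows "4 * (u * cnj v) =
    of_real ((norm (u + 1 * v))\<^sup>2) - of_real ((norm (u + (-1) * v))\<^sup>2)
    + \<i> * of_real ((norm (u + \<i> * v))\<^sup>2) - \<i> * of_real ((norm (u + (- \<i>) * v))\<^sup>2)"
  unfolding complex_norm_square by (simp add: algebra_simps)

text \<open>By polarization an inner product is a combination of four squared norms, so a map that
  scales these four by \<open>K\<close> scales the inner product by \<open>K\<close>.\<close>

lemma isometry_preserves_inner:
  assumes u: "square_integrable M u" and v: "square_integrable M v"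
    and U: "square_integrable N U" and V: "square_integrable N V"
    and iso: "\<And>c. c \<in> {1, -1, \<i>, -\<i>} \<Longrightarrow>
      (LINT x|N. (norm (U x + c * V x))\<^sup>2) = K * (LINT x|M. (norm (u x + c * v x))\<^sup>2)"
  shows "(LINT x|N. U x * cnj (V x)) = of_real K * (LINT x|M. u x * cnj (v x))"
proof -
  have polar: "4 * (LINT x|L. f x * cnj (g x)) =
      of_real (LINT x|L. (norm (f x + 1 * g x))\<^sup>2) - of_real (LINT x|L. (norm (f x + (-1) * g x))\<^sup>2)
    + \<i> * of_real (LINT x|L. (norm (f x + \<i> * g x))\<^sup>2)
    - \<i> * of_real (LINT x|L. (norm (f x + (- \<i>) * g x))\<^sup>2)"
    if f: "square_integrable L f" and g: "square_integrable L g"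
    for L :: "'z measure" and f g
  proof -
    have int: "integrable L (\<lambda>x. complex_of_real ((norm (f x + c * g x))\<^sup>2))" for c
      using square_integrable_integrable[OF square_integrable_add[OF f square_integrable_cmult[OF g]]]
      by (rule integrable_of_real)
    have "4 * (LINT x|L. f x * cnj (g x)) = (LINT x|L. 4 * (f x * cnj (g x)))"
      by simp
    also have "\<dots> = (LINT x|L. of_real ((norm (f x + 1 * g x))\<^sup>2) - of_real ((norm (f x + (-1) * g x))\<^sup>2)
      + \<i> * of_real ((norm (f x + \<i> * g x))\<^sup>2) - \<i> * of_real ((norm (f x + (- \<i>) * g x))\<^sup>2))"
      unfolding polarization ..
    also have "\<dots> = of_real (LINT x|L. (norm (f x + 1 * g x))\<^sup>2)
        - of_real (LINT x|L. (norm (f x + (-1) * g x))\<^sup>2)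
        + \<i> * of_real (LINT x|L. (norm (f x + \<i> * g x))\<^sup>2)
        - \<i> * of_real (LINT x|L. (norm (f x + (- \<i>) * g x))\<^sup>2)"
      by (simp only: Bochner_Integration.integral_diff Bochner_Integration.integral_add
          Bochner_Integration.integrable_diff Bochner_Integration.integrable_add
          integral_mult_right_zero integrable_mult_right int integral_complex_of_real)
    finally show ?thesis .
  qed
  have "4 * (LINT x|N. U x * cnj (V x)) = 4 * (of_real K * (LINT x|M. u x * cnj (v x)))"
    unfolding polar[OF U V] mult.left_commute[of 4 "complex_of_real K"] polar[OF u v]
    using iso[of 1] iso[of "-1"] iso[of \<i>] iso[of "-\<i>"] by (simp only: insertI1 insertI2 of_real_mult) (simp add: algebra_simps)
  then show ?thesis by simp
qed

text \<open>Cutoffs take a square integrable function into \<open>L\<^sup>1 \<inter> L\<^sup>2\<close>, where Fourier integrals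
  converge absolutely. They run over the same intervals as the truncations that define the
  Plancherel sense of the SAFT.\<close>

definition cutoff :: "nat \<Rightarrow> (real \<Rightarrow> complex) \<Rightarrow> real \<Rightarrow> complex" where
  "cutoff n f t = indicator {- real n..real n} t *\<^sub>R f t"

lemma cutoff_measurable [measurable]:
  "f \<in> borel_measurable borel \<Longrightarrow> cutoff n f \<in> borel_measurable borel"
  unfolding cutoff_def[abs_def] by measurable

lemma norm_cutoff_le: "norm (cutoff n f t) \<le> norm (f t)"
  by (auto simp: cutoff_def indicator_def)

lemma cutoff_tendsto: "(\<lambda>n. cutoff n f t) \<longlonglongrightarrow> f t"
proof (rule tendsto_eventually)
  obtain N where "\<bar>t\<bar> \<le> real N" using real_arch_simple by blast
  then show "\<forall>\<^sub>F n in sequentially. cutoff n f t = f t"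
    by (intro eventually_sequentiallyI[of N]) (auto simp: cutoff_def indicator_def)
qed

lemma square_integrable_cutoff:
  assumes "square_integrable lborel f"
  shows "square_integrable lborel (cutoff n f)"
  using square_integrable_bound[OF assms, of "cutoff n f" 1] square_integrable_measurable[OF assms]
  by (auto simp: norm_cutoff_le)

lemma square_integrable_indicator_interval:
  "square_integrable lborel (\<lambda>t::real. complex_of_real (indicator {- real n..real n} t))"
proof -
  have "(\<lambda>t. (indicat_real {- real n..real n} t)\<^sup>2) = indicat_real {- real n..real n}"
    by (auto simp: indicator_def)
  then show ?thesis
    by (simp add: square_integrable_def)
qed

lemma integrable_cutoff:
  assumes "square_integrable lborel f"
  shows "integrable lborel (cutoff n f)"
  using square_integrable_mult_integrable[OF square_integrable_indicator_interval assms]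
  by (simp add: cutoff_def[abs_def] scaleR_conv_of_real)

lemma square_integrable_cutoff_bounded:
  fixes f :: "real \<Rightarrow> complex"
  assumes [measurable]: "f \<in> borel_measurable borel" and le: "\<And>t. norm (f t) \<le> K"
  shows "square_integrable lborel (cutoff n f)"
  by (rule square_integrable_bound[OF square_integrable_indicator_interval, where K=K])
     (use le in \<open>auto simp: cutoff_def indicator_def\<close>)

lemma cutoff_tendsto_L2:
  assumes f: "square_integrable lborel f"
  shows "(\<lambda>n. LINT t|lborel. (norm (cutoff n f t - f t))\<^sup>2) \<longlonglongrightarrow> 0"
proof -
  note [measurable] = square_integrable_measurable[OF f]
  have "(\<lambda>n. LINT t|lborel. (norm (cutoff n f t - f t))\<^sup>2) \<longlonglongrightarrow> integral\<^sup>L lborel (\<lambda>t::real. 0)"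
  proof (rule integral_dominated_convergence[where w="\<lambda>t. (norm (f t))\<^sup>2"])
    show "AE t in lborel. (\<lambda>n. (norm (cutoff n f t - f t))\<^sup>2) \<longlonglongrightarrow> 0"
    proof (rule AE_I2)
      show "(\<lambda>n. (norm (cutoff n f t - f t))\<^sup>2) \<longlonglongrightarrow> 0" for t
        using tendsto_power[OF tendsto_norm[OF LIM_zero[OF cutoff_tendsto[of f t]]], where n=2] by simp
    qed
    show "AE t in lborel. norm ((norm (cutoff n f t - f t))\<^sup>2) \<le> (norm (f t))\<^sup>2" for n
      by (auto simp: cutoff_def indicator_def)
  qed (use square_integrable_integrable[OF f] in auto)
  then show ?thesis by simp
qed

section \<open>Continuity of translations\<close>

lemma integral_translate:
  fixes u :: "real \<Rightarrow> 'b::{banach, second_countable_topology}"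
  shows "(LINT x|lborel. u (x + z)) = (LINT x|lborel. u x)"
  using lborel_integral_real_affine[of 1 u z] by (simp add: add.commute)

lemma integrable_translate:
  fixes u :: "real \<Rightarrow> 'b::{banach, second_countable_topology}"
  shows "integrable lborel u \<Longrightarrow> integrable lborel (\<lambda>x. u (x + z))"
  using lborel_integrable_real_affine[of u 1 z] by (simp add: add.commute)

lemma square_integrable_translate:
  fixes u :: "real \<Rightarrow> complex"
  shows "square_integrable lborel u \<Longrightarrow> square_integrable lborel (\<lambda>x. u (x + z))"
  using integrable_translate[of "\<lambda>x. (norm (u x))\<^sup>2" z] by (auto simp: square_integrable_def)

text \<open>An \<open>\<epsilon>/3\<close> argument: since Lebesgue measure is translation invariant, \<open>u\<close> and its translate
  are equally well approximated by \<open>v\<close> and its translate.\<close>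

lemma translation_tendsto_approx:
  fixes u :: "real \<Rightarrow> complex"
  assumes u: "integrable lborel u"
    and approx: "\<And>e. e > 0 \<Longrightarrow> \<exists>v. integrable lborel v \<and> (LINT x|lborel. norm (u x - v x)) \<le> e \<and>
      (\<lambda>n. LINT x|lborel. norm (v (x + z n) - v x)) \<longlonglongrightarrow> 0"
  shows "(\<lambda>n. LINT x|lborel. norm (u (x + z n) - u x)) \<longlonglongrightarrow> 0"
proof (rule LIMSEQ_I)
  fix e :: real assume "e > 0"
  then obtain v where v: "integrable lborel v" "(LINT x|lborel. norm (u x - v x)) \<le> e / 3"
    and lim: "(\<lambda>n. LINT x|lborel. norm (v (x + z n) - v x)) \<longlonglongrightarrow> 0"
    using approx[of "e / 3"] by auto
  from LIMSEQ_D[OF lim, of "e / 3"] \<open>e > 0\<close>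
  obtain N where N: "\<And>n. n \<ge> N \<Longrightarrow> (LINT x|lborel. norm (v (x + z n) - v x)) < e / 3"
    by auto
  have "norm ((LINT x|lborel. norm (u (x + z n) - u x)) - 0) < e" if "n \<ge> N" for n
  proof -
    note [simp] = u v(1) integrable_translate[OF u] integrable_translate[OF v(1)]
    have "(LINT x|lborel. norm (u (x + z n) - u x))
        \<le> (LINT x|lborel. norm (u (x + z n) - v (x + z n)) + norm (v (x + z n) - v x) + norm (u x - v x))"
    proof (rule integral_mono)
      show "norm (u (x + z n) - u x)
          \<le> norm (u (x + z n) - v (x + z n)) + norm (v (x + z n) - v x) + norm (u x - v x)" for x
        using norm_triangle_ineq[of "u (x + z n) - v (x + z n) + (v (x + z n) - v x)" "v x - u x"]
          norm_triangle_ineq[of "u (x + z n) - v (x + z n)" "v (x + z n) - v x"]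
        by (simp add: norm_minus_commute[of "v x" "u x"])
    qed simp_all
    also have "\<dots> = (LINT x|lborel. norm (u x - v x)) + (LINT x|lborel. norm (v (x + z n) - v x))
        + (LINT x|lborel. norm (u x - v x))"
      using integral_translate[of "\<lambda>x. norm (u x - v x)" "z n"] by simp
    also have "\<dots> < e"
      using v(2) N[OF that] by simp
    finally show ?thesis
      by (simp add: integral_nonneg_AE)
  qed
  then show "\<exists>N. \<forall>n\<ge>N. norm ((LINT x|lborel. norm (u (x + z n) - u x)) - 0) < e"
    by blast
qed

text \<open>For \<open>x \<in> U\<close> the translate \<open>x + z n\<close> eventually stays in the open set \<open>U\<close>, so the part of
  \<open>U\<close> lost by translation has measure tending to \<open>0\<close>. As \<open>U\<close> and its translates have the same
  finite measure, the part gained is equally small.\<close>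

lemma translation_tendsto_open:
  fixes U :: "real set" and c :: complex
  assumes U: "open U" "emeasure lborel U < \<infinity>" and z: "z \<longlonglongrightarrow> 0"
  shows "(\<lambda>n. LINT x|lborel. norm (indicator U (x + z n) *\<^sub>R c - indicator U x *\<^sub>R c)) \<longlonglongrightarrow> 0"
proof -
  have [measurable]: "U \<in> sets borel" using U by auto
  have intU: "integrable lborel (indicat_real U)"
    using U by (simp add: integrable_indicator_iff)
  have intUz: "integrable lborel (\<lambda>x. indicat_real U (x + z n))" for n
    using integrable_translate[OF intU] .
  have intw: "integrable lborel (\<lambda>x. indicat_real U x * (1 - indicator U (x + z n)))" for n
    by (rule Bochner_Integration.integrable_bound[OF intU])
       (measurable, auto simp: indicator_def)
  have eq: "(LINT x|lborel. norm (indicator U (x + z n) *\<^sub>R c - indicator U x *\<^sub>R c))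
      = 2 * norm c * (LINT x|lborel. indicat_real U x * (1 - indicator U (x + z n)))" for n
  proof -
    have "(LINT x|lborel. norm (indicator U (x + z n) *\<^sub>R c - indicator U x *\<^sub>R c))
       = (LINT x|lborel. norm c * (indicat_real U (x + z n) - indicat_real U x
            + 2 * (indicat_real U x * (1 - indicator U (x + z n)))))"
      by (intro Bochner_Integration.integral_cong) (auto simp: indicator_def)
    also have "\<dots> = 2 * norm c * (LINT x|lborel. indicat_real U x * (1 - indicator U (x + z n)))"
      using intU intUz intw integral_translate[of "indicat_real U" "z n"] by simp
    finally show ?thesis .
  qed
  have "(\<lambda>n. LINT x|lborel. indicat_real U x * (1 - indicator U (x + z n)))
      \<longlonglongrightarrow> integral\<^sup>L lborel (\<lambda>x::real. 0::real)"
  proof (rule integral_dominated_convergence[where w="indicat_real U"])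
    show "AE x in lborel. (\<lambda>n. indicat_real U x * (1 - indicator U (x + z n))) \<longlonglongrightarrow> 0"
    proof (rule AE_I2)
      fix x
      have "\<forall>\<^sub>F n in sequentially. indicat_real U x * (1 - indicator U (x + z n)) = 0"
      proof (cases "x \<in> U")
        case True
        have "(\<lambda>n. x + z n) \<longlonglongrightarrow> x"
          using tendsto_add[OF tendsto_const z, of x] by simp
        from topological_tendstoD[OF this U(1) True] show ?thesis
          by eventually_elim simp
      qed simp
      then show "(\<lambda>n. indicat_real U x * (1 - indicator U (x + z n))) \<longlonglongrightarrow> 0"
        by (rule tendsto_eventually)
    qed
    show "AE x in lborel. norm (indicat_real U x * (1 - indicator U (x + z n))) \<le> indicat_real U x" for n
      by (auto simp: indicator_def)
  qed (use intU in auto)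
  then show ?thesis
    unfolding eq by (intro tendsto_mult_right_zero) simp
qed

text \<open>Outer regularity approximates every set of finite measure by open sets, and integrable
  functions arise from indicators of such sets by sums and dominated limits.\<close>

lemma translation_tendsto_L1:
  fixes u :: "real \<Rightarrow> complex"
  assumes u: "integrable lborel u" and z: "z \<longlonglongrightarrow> 0"
  shows "(\<lambda>n. LINT x|lborel. norm (u (x + z n) - u x)) \<longlonglongrightarrow> 0"
  using u
proof (induction rule: integrable_induct)
  case (base A c)
  have [measurable]: "A \<in> sets borel" using base by simp
  show ?case
  proof (rule translation_tendsto_approx)
    show "integrable lborel (\<lambda>x. indicator A x *\<^sub>R c)"
      using base by (intro integrable_scaleR_left) (simp add: integrable_indicator_iff)
    fix e :: real assume "e > 0"
    define d where "d = e / (norm c + 1)"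
    have "d > 0" using \<open>e > 0\<close> by (simp add: d_def add_nonneg_pos)
    then obtain U where U: "open U" "A \<subseteq> U" "emeasure lborel (U - A) < d"
      using outer_regular_lborel[of A d] by auto
    have [measurable]: "U \<in> sets borel" using U by auto
    have "emeasure lborel U = emeasure lborel A + emeasure lborel (U - A)"
      using U(2) by (subst plus_emeasure) (auto intro: arg_cong[of _ _ "emeasure lborel"])
    also have "\<dots> < \<infinity>"
      using base U(3) by (auto intro: less_trans)
    finally have fin: "emeasure lborel U < \<infinity>" .
    have "measure lborel (U - A) \<le> d"
      using U(3) \<open>d > 0\<close> unfolding measure_def by (intro enn2real_leI) auto
    then have m: "norm c * measure lborel (U - A) \<le> norm c * d"
      by (intro mult_left_mono) auto
    have "norm c * d \<le> e"
      using \<open>e > 0\<close> norm_ge_zero[of c] by (simp add: d_def divide_le_eq algebra_simps del: norm_ge_zero)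
    moreover have "(LINT x|lborel. norm (indicator A x *\<^sub>R c - indicator U x *\<^sub>R c))
        = (LINT x|lborel. norm c * indicat_real (U - A) x)"
      using U(2) by (intro Bochner_Integration.integral_cong) (auto simp: indicator_def)
    moreover have "integrable lborel (\<lambda>x. indicator U x *\<^sub>R c)"
      using fin by (intro integrable_scaleR_left) (simp add: integrable_indicator_iff)
    ultimately show "\<exists>v. integrable lborel v \<and>
        (LINT x|lborel. norm (indicator A x *\<^sub>R c - v x)) \<le> e \<and>
        (\<lambda>n. LINT x|lborel. norm (v (x + z n) - v x)) \<longlonglongrightarrow> 0"
      using translation_tendsto_open[OF U(1) fin z, of c] m
      by (intro exI[of _ "\<lambda>x. indicator U x *\<^sub>R c"]) simp
  qed
next
  case (add f g)
  note [simp] = add.hyps integrable_translate[OF add.hyps(1)] integrable_translate[OF add.hyps(2)]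
  have le: "norm (LINT x|lborel. norm (f (x + z n) + g (x + z n) - (f x + g x)))
      \<le> (LINT x|lborel. norm (f (x + z n) - f x)) + (LINT x|lborel. norm (g (x + z n) - g x))" for n
  proof -
    have "(LINT x|lborel. norm (f (x + z n) + g (x + z n) - (f x + g x)))
        \<le> (LINT x|lborel. norm (f (x + z n) - f x) + norm (g (x + z n) - g x))"
    proof (rule integral_mono)
      show "norm (f (x + z n) + g (x + z n) - (f x + g x))
          \<le> norm (f (x + z n) - f x) + norm (g (x + z n) - g x)" for x
        using norm_triangle_ineq[of "f (x + z n) - f x" "g (x + z n) - g x"]
        by (simp add: algebra_simps)
    qed simp_all
    then show ?thesis by (simp add: integral_nonneg_AE)
  qed
  have "(\<lambda>n. (LINT x|lborel. norm (f (x + z n) - f x)) + (LINT x|lborel. norm (g (x + z n) - g x))) \<longlonglongrightarrow> 0"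
    using tendsto_add[OF add.IH] by simp
  then show ?case
    by (rule Lim_null_comparison[OF always_eventually[OF allI[OF le]]])
next
  case (lim f s)
  show ?case
  proof (rule translation_tendsto_approx[OF lim.hyps(4)])
    fix e :: real assume "e > 0"
    have "(\<lambda>i. LINT x|lborel. norm (f x - s i x)) \<longlonglongrightarrow> integral\<^sup>L lborel (\<lambda>x::real. 0::real)"
    proof (rule integral_dominated_convergence[where w="\<lambda>x. 3 * norm (f x)"])
      show "AE x in lborel. (\<lambda>i. norm (f x - s i x)) \<longlonglongrightarrow> 0"
      proof (rule AE_I2)
        fix x
        show "(\<lambda>i. norm (f x - s i x)) \<longlonglongrightarrow> 0"
          using tendsto_norm[OF tendsto_diff[OF tendsto_const[of "f x"] lim.hyps(2)[of x]]] by simp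
      qed
      show "AE x in lborel. norm (norm (f x - s i x)) \<le> 3 * norm (f x)" for i
      proof (rule AE_I2)
        fix x
        show "norm (norm (f x - s i x)) \<le> 3 * norm (f x)"
          using norm_triangle_ineq4[of "f x" "s i x"] lim.hyps(3)[of x i] by simp
      qed
    qed (use lim.hyps in auto)
    then have "(\<lambda>i. LINT x|lborel. norm (f x - s i x)) \<longlonglongrightarrow> 0" by simp
    from LIMSEQ_D[OF this \<open>e > 0\<close>] obtain i where "norm ((LINT x|lborel. norm (f x - s i x)) - 0) < e"
      by blast
    then have "(LINT x|lborel. norm (f x - s i x)) \<le> e"
      by simp
    then show "\<exists>v. integrable lborel v \<and> (LINT x|lborel. norm (f x - v x)) \<le> e \<and>
        (\<lambda>n. LINT x|lborel. norm (v (x + z n) - v x)) \<longlonglongrightarrow> 0"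
      using lim.hyps(1) lim.IH by blast
  qed
qed

text \<open>This inequality passes from \<open>L\<^sup>1\<close> to \<open>L\<^sup>2\<close>: applied to the values of \<open>u\<close>, its right-hand side
  is an \<open>L\<^sup>1\<close> distance for the integrable function \<open>|u| u\<close>. The inner product of
  \<open>|a| a - |b| b\<close> with \<open>a - b\<close> is at least \<open>(|a| + |b|) |a - b|\<^sup>2 / 2\<close>, hence at least
  \<open>|a - b|\<^sup>3 / 2\<close>.\<close>

lemma norm_diff_square_le:
  fixes a b :: "'a::real_inner"
  shows "(norm (a - b))\<^sup>2 \<le> 2 * norm (norm a *\<^sub>R a - norm b *\<^sub>R b)"
proof (cases "a = b")
  case False
  let ?s = "norm a + norm b"
  have "norm (a - b) * (norm (a - b))\<^sup>2 \<le> ?s * (norm (a - b))\<^sup>2"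
    by (intro mult_right_mono norm_triangle_ineq4) auto
  also have "\<dots> \<le> ?s * (norm (a - b))\<^sup>2 + (norm a - norm b) * ((norm a)\<^sup>2 - (norm b)\<^sup>2)"
  proof -
    have "(norm a - norm b) * ((norm a)\<^sup>2 - (norm b)\<^sup>2) = (norm a - norm b)\<^sup>2 * ?s"
      by (simp add: power2_eq_square algebra_simps)
    then show ?thesis by simp
  qed
  also have "\<dots> = 2 * inner (norm a *\<^sub>R a - norm b *\<^sub>R b) (a - b)"
    by (simp add: power2_norm_eq_inner inner_diff_left inner_diff_right inner_commute algebra_simps)
  also have "\<dots> \<le> 2 * (norm (norm a *\<^sub>R a - norm b *\<^sub>R b) * norm (a - b))"
    using norm_cauchy_schwarz by (intro mult_left_mono) auto
  finally show ?thesis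
    using False by (simp add: mult.assoc mult.left_commute)
qed simp

lemma translation_tendsto_L2:
  fixes u :: "real \<Rightarrow> complex"
  assumes u: "square_integrable lborel u" and z: "z \<longlonglongrightarrow> 0"
  shows "(\<lambda>n. LINT x|lborel. (norm (u (x + z n) - u x))\<^sup>2) \<longlonglongrightarrow> 0"
proof -
  note [measurable] = square_integrable_measurable[OF u]
  define v where "v x = norm (u x) *\<^sub>R u x" for x
  have v: "integrable lborel v"
  proof (rule Bochner_Integration.integrable_bound[OF square_integrable_integrable[OF u]])
    show "v \<in> borel_measurable lborel" unfolding v_def by measurable
  qed (simp add: v_def power2_eq_square)
  have le: "norm (LINT x|lborel. (norm (u (x + z n) - u x))\<^sup>2)
      \<le> 2 * (LINT x|lborel. norm (v (x + z n) - v x))" for n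
  proof -
    have "(LINT x|lborel. (norm (u (x + z n) - u x))\<^sup>2)
        \<le> (LINT x|lborel. 2 * norm (v (x + z n) - v x))"
    proof (rule integral_mono)
      show "integrable lborel (\<lambda>x. (norm (u (x + z n) - u x))\<^sup>2)"
        by (rule square_integrable_integrable[OF square_integrable_diff[OF square_integrable_translate[OF u] u]])
      show "integrable lborel (\<lambda>x. 2 * norm (v (x + z n) - v x))"
        using v integrable_translate[OF v] by simp
    qed (simp add: v_def norm_diff_square_le)
    then show ?thesis by (simp add: integral_nonneg_AE)
  qed
  have "(\<lambda>n. 2 * (LINT x|lborel. norm (v (x + z n) - v x))) \<longlonglongrightarrow> 0"
    using tendsto_mult_right_zero[OF translation_tendsto_L1[OF v z]] .
  then show ?thesis
    by (rule Lim_null_comparison[OF always_eventually[OF allI[OF le]]])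
qed

section \<open>The Fourier transform and Plancherel's theorem\<close>

lemma borel_measurable_cis [measurable]: "cis \<in> borel_measurable borel"
  by (intro borel_measurable_continuous_onI continuous_intros)

lemma integrable_mult_unimodular:
  fixes u :: "'a \<Rightarrow> complex"
  assumes "integrable M u" "w \<in> borel_measurable M" "\<And>x. norm (w x) \<le> 1"
  shows "integrable M (\<lambda>x. u x * w x)"
proof (rule Bochner_Integration.integrable_bound[OF assms(1)])
  show "(\<lambda>x. u x * w x) \<in> borel_measurable M" using assms by measurable
  show "AE x in M. norm (u x * w x) \<le> norm (u x)"
    using assms(3) by (intro AE_I2) (simp add: norm_mult mult_left_le)
qed

text \<open>In this normalization Plancherel's theorem carries the factor \<open>2\<pi>\<close>.\<close>

definition fourier :: "(real \<Rightarrow> complex) \<Rightarrow> real \<Rightarrow> complex" where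
  "fourier u \<xi> = (LINT t|lborel. u t * cis (- (\<xi> * t)))"

lemma fourier_measurable [measurable]:
  assumes [measurable]: "u \<in> borel_measurable borel"
  shows "fourier u \<in> borel_measurable borel"
  unfolding fourier_def[abs_def] by measurable

lemma fourier_integrand:
  "integrable lborel u \<Longrightarrow> integrable lborel (\<lambda>t. u t * cis (- (\<xi> * t)))"
  by (rule integrable_mult_unimodular) auto

lemma norm_fourier_le: "norm (fourier u \<xi>) \<le> (LINT t|lborel. norm (u t))"
  using integral_norm_bound[of lborel "\<lambda>t. u t * cis (- (\<xi> * t))"]
  by (simp add: fourier_def norm_mult)

lemma fourier_multiplication_formula:
  assumes u: "integrable lborel u" and v: "integrable lborel v"
  shows "(LINT \<xi>|lborel. fourier u \<xi> * v \<xi>) = (LINT t|lborel. u t * fourier v t)"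
proof -
  note [measurable] = borel_measurable_integrable[OF u] borel_measurable_integrable[OF v]
  have "integrable (lborel \<Otimes>\<^sub>M lborel) (\<lambda>(t, \<xi>). u t * v \<xi> * cis (- (\<xi> * t)))"
  proof (rule lborel_pair.Fubini_integrable)
    show "AE t in lborel. integrable lborel (\<lambda>\<xi>. case (t, \<xi>) of (t, \<xi>) \<Rightarrow> u t * v \<xi> * cis (- (\<xi> * t)))"
      using v by (intro AE_I2) (auto intro!: integrable_mult_unimodular integrable_mult_right)
    show "integrable lborel (\<lambda>t. LINT \<xi>|lborel. norm (case (t, \<xi>) of (t, \<xi>) \<Rightarrow> u t * v \<xi> * cis (- (\<xi> * t))))"
      using u by (simp add: norm_mult)
  qed measurable
  from lborel_pair.Fubini_integral[OF this]
  have "(LINT \<xi>|lborel. LINT t|lborel. u t * v \<xi> * cis (- (\<xi> * t)))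
      = (LINT t|lborel. LINT \<xi>|lborel. u t * v \<xi> * cis (- (\<xi> * t)))" .
  moreover have "(LINT t|lborel. u t * v \<xi> * cis (- (\<xi> * t))) = fourier u \<xi> * v \<xi>" for \<xi>
    unfolding fourier_def by (subst integral_mult_left_zero[symmetric]) (simp add: ac_simps)
  moreover have "(LINT \<xi>|lborel. u t * v \<xi> * cis (- (\<xi> * t))) = u t * fourier v t" for t
    unfolding fourier_def by (subst integral_mult_right_zero[symmetric]) (simp add: ac_simps)
  ultimately show ?thesis by simp
qed

definition autocorrelation :: "(real \<Rightarrow> complex) \<Rightarrow> real \<Rightarrow> complex" where
  "autocorrelation u z = (LINT x|lborel. u (x + z) * cnj (u x))"

text \<open>The autocorrelation is the convolution of \<open>u\<close> with its conjugate reflection, whose Fourier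
  transforms are \<open>fourier u\<close> and its conjugate.\<close>

lemma
  assumes u: "integrable lborel u"
  shows integrable_autocorrelation: "integrable lborel (autocorrelation u)"
    and fourier_autocorrelation: "fourier (autocorrelation u) \<xi> = of_real ((norm (fourier u \<xi>))\<^sup>2)"
proof -
  note [measurable] = borel_measurable_integrable[OF u]
  have ushift: "integrable lborel (\<lambda>z. u (x + z))" for x
    using integrable_translate[OF u, of x] by (simp add: add.commute)
  have int: "integrable (lborel \<Otimes>\<^sub>M lborel) (\<lambda>(x, z). u (x + z) * cnj (u x))"
  proof (rule lborel_pair.Fubini_integrable)
    show "AE x in lborel. integrable lborel (\<lambda>z. case (x, z) of (x, z) \<Rightarrow> u (x + z) * cnj (u x))"
      using ushift by simp
    have "(LINT z|lborel. norm (u (x + z))) = (LINT z|lborel. norm (u z))" for x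
      using integral_translate[of "\<lambda>z. norm (u z)" x] by (simp add: add.commute)
    then show "integrable lborel (\<lambda>x. LINT z|lborel. norm (case (x, z) of (x, z) \<Rightarrow> u (x + z) * cnj (u x)))"
      using u by (simp add: norm_mult)
  qed measurable
  from lborel_pair.integrable_snd[OF this] show "integrable lborel (autocorrelation u)"
    by (simp add: autocorrelation_def[abs_def])
  have "integrable (lborel \<Otimes>\<^sub>M lborel)
      (\<lambda>p. (case p of (x, z) \<Rightarrow> u (x + z) * cnj (u x)) * (case p of (x, z) \<Rightarrow> cis (- (\<xi> * z))))"
    by (rule integrable_mult_unimodular[OF int]) (auto split: prod.split)
  then have int': "integrable (lborel \<Otimes>\<^sub>M lborel)
      (\<lambda>(x, z). u (x + z) * cnj (u x) * cis (- (\<xi> * z)))"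
    by (simp add: case_prod_unfold)
  have "fourier (autocorrelation u) \<xi>
      = (LINT z|lborel. LINT x|lborel. u (x + z) * cnj (u x) * cis (- (\<xi> * z)))"
    unfolding fourier_def autocorrelation_def by simp
  also have "\<dots> = (LINT x|lborel. LINT z|lborel. u (x + z) * cnj (u x) * cis (- (\<xi> * z)))"
    by (rule lborel_pair.Fubini_integral[OF int'])
  also have "\<dots> = (LINT x|lborel. cnj (u x * cis (- (\<xi> * x))) * fourier u \<xi>)"
  proof (rule Bochner_Integration.integral_cong[OF refl])
    fix x
    have "(LINT z|lborel. u (x + z) * cnj (u x) * cis (- (\<xi> * z)))
        = (LINT z|lborel. cnj (u x * cis (- (\<xi> * x))) * (u (z + x) * cis (- (\<xi> * (z + x)))))"
    proof (rule Bochner_Integration.integral_cong[OF refl])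
      fix z
      have "cis (\<xi> * x) * cis (- (\<xi> * (z + x))) = cis (- (\<xi> * z))"
        by (simp add: cis_mult algebra_simps)
      from this[symmetric] show "u (x + z) * cnj (u x) * cis (- (\<xi> * z))
          = cnj (u x * cis (- (\<xi> * x))) * (u (z + x) * cis (- (\<xi> * (z + x))))"
        by (simp add: cis_cnj ac_simps)
    qed
    also have "\<dots> = cnj (u x * cis (- (\<xi> * x))) * fourier u \<xi>"
      using integral_translate[of "\<lambda>z. u z * cis (- (\<xi> * z))" x]
      by (simp add: fourier_def)
    finally show "(LINT z|lborel. u (x + z) * cnj (u x) * cis (- (\<xi> * z)))
        = cnj (u x * cis (- (\<xi> * x))) * fourier u \<xi>" .
  qed
  also have "\<dots> = cnj (fourier u \<xi>) * fourier u \<xi>"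
    unfolding fourier_def by (simp only: integral_mult_left_zero Bochner_Integration.integral_cnj)
  finally show "fourier (autocorrelation u) \<xi> = of_real ((norm (fourier u \<xi>))\<^sup>2)"
    by (simp only: complex_norm_square mult.commute)
qed

lemma fourier_gaussian:
  assumes e: "e > 0"
  shows "fourier (\<lambda>\<xi>. of_real (std_normal_density (e * \<xi>))) z
      = of_real (sqrt (2 * pi) / e * std_normal_density (z / e))"
proof -
  have "fourier (\<lambda>\<xi>. of_real (std_normal_density (e * \<xi>))) z
      = (1 / e) *\<^sub>R (LINT s|lborel. of_real (std_normal_density s) * cis (- (z / e * s)))"
    unfolding fourier_def using e
    by (subst lborel_integral_real_affine[of "1 / e" _ 0]) (simp_all add: field_simps)
  also have "(LINT s|lborel. of_real (std_normal_density s) * cis (- (z / e * s)))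
      = char std_normal_distribution (- (z / e))"
    unfolding char_def
    by (subst integral_density) (simp_all add: scaleR_conv_of_real cis_conv_exp)
  also have "\<dots> = of_real (exp (- (z / e)\<^sup>2 / 2))"
    unfolding char_std_normal_distribution by (simp only: power2_minus)
  finally show ?thesis
    using e by (simp add: std_normal_density_def scaleR_conv_of_real)
qed

text \<open>The multiplication formula moves the Fourier transform from the autocorrelation to the
  Gaussian. A wide Gaussian on the frequency side becomes a narrow one around \<open>0\<close>, where the
  autocorrelation has the value \<open>\<parallel>u\<parallel>\<^sup>2\<close>.\<close>

lemma gaussian_mean_of_fourier_square:
  assumes u: "integrable lborel u" and e: "e > 0"
  shows "(LINT \<xi>|lborel. of_real ((norm (fourier u \<xi>))\<^sup>2 * std_normal_density (e * \<xi>)))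
      = of_real (sqrt (2 * pi)) * (LINT s|lborel. of_real (std_normal_density s) * autocorrelation u (e * s))"
proof -
  have gauss: "integrable lborel (\<lambda>\<xi>. std_normal_density (e * \<xi>))"
    using lborel_integrable_real_affine[of std_normal_density e 0] e by simp
  have "(LINT \<xi>|lborel. complex_of_real ((norm (fourier u \<xi>))\<^sup>2 * std_normal_density (e * \<xi>)))
      = (LINT \<xi>|lborel. fourier (autocorrelation u) \<xi> * of_real (std_normal_density (e * \<xi>)))"
    by (simp only: fourier_autocorrelation[OF u] of_real_mult)
  also have "\<dots> = (LINT z|lborel. autocorrelation u z * of_real (sqrt (2 * pi) / e * std_normal_density (z / e)))"
    using fourier_multiplication_formula[OF integrable_autocorrelation[OF u] integrable_of_real[OF gauss]]
    by (simp only: fourier_gaussian[OF e])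
  also have "\<dots> = e *\<^sub>R (LINT s|lborel. autocorrelation u (e * s) * of_real (sqrt (2 * pi) / e * std_normal_density s))"
    using e by (subst lborel_integral_real_affine[of e _ 0]) simp_all
  also have "\<dots> = (LINT s|lborel. of_real (sqrt (2 * pi)) * (of_real (std_normal_density s) * autocorrelation u (e * s)))"
    using e by (subst integral_scaleR_right[symmetric])
      (intro Bochner_Integration.integral_cong, simp_all add: scaleR_conv_of_real)
  finally show ?thesis by simp
qed

lemma autocorrelation_tendsto:
  assumes u: "square_integrable lborel u" and z: "z \<longlonglongrightarrow> 0"
  shows "(\<lambda>n. autocorrelation u (z n)) \<longlonglongrightarrow> of_real (LINT x|lborel. (norm (u x))\<^sup>2)"
proof -
  have "(\<lambda>n. autocorrelation u (z n)) \<longlonglongrightarrow> (LINT x|lborel. u x * cnj (u x))"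
    unfolding autocorrelation_def
    by (rule square_integrable_inner_tendsto[OF u square_integrable_translate[OF u]
          translation_tendsto_L2[OF u z] square_integrable_cnj[OF u]])
  also have "(LINT x|lborel. u x * cnj (u x)) = of_real (LINT x|lborel. (norm (u x))\<^sup>2)"
    by (simp only: complex_norm_square[symmetric] integral_complex_of_real)
  finally show ?thesis .
qed

lemma norm_autocorrelation_le:
  assumes u: "square_integrable lborel u"
  shows "norm (autocorrelation u z) \<le> (LINT x|lborel. (norm (u x))\<^sup>2)"
proof -
  have "(norm (autocorrelation u z))\<^sup>2 \<le> (LINT x|lborel. (norm (u x))\<^sup>2)\<^sup>2"
    using square_integrable_Cauchy_Schwarz_inner[OF square_integrable_translate[OF u, of z]
        square_integrable_cnj[OF u]] integral_translate[of "\<lambda>x. (norm (u x))\<^sup>2" z]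
    by (simp add: autocorrelation_def power2_eq_square)
  then show ?thesis
    by (rule power2_le_imp_le) (simp add: integral_nonneg_AE)
qed

text \<open>Let the Gaussians in \<open>gaussian_mean_of_fourier_square\<close> widen. On the frequency side they increase to a constant, so
  monotone convergence gives the integral of \<open>|fourier u|\<^sup>2\<close>, including its finiteness. On the other
  side the autocorrelation is bounded and continuous at \<open>0\<close>, so dominated convergence leaves its
  value there.\<close>

theorem Plancherel:
  assumes u1: "integrable lborel u" and u2: "square_integrable lborel u"
  shows "square_integrable lborel (fourier u)"
    and "(LINT \<xi>|lborel. (norm (fourier u \<xi>))\<^sup>2) = 2 * pi * (LINT x|lborel. (norm (u x))\<^sup>2)"
proof -
  note [measurable] = borel_measurable_integrable[OF u1]
  have r_meas [measurable]: "autocorrelation u \<in> borel_measurable borel"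
    using borel_measurable_integrable[OF integrable_autocorrelation[OF u1]] by simp
  let ?K = "LINT x|lborel. (norm (u x))\<^sup>2"
  have K: "?K \<ge> 0" by (simp add: integral_nonneg_AE)
  define e where "e n = 1 / real (Suc n)" for n
  have e_pos: "e n > 0" for n by (simp add: e_def)
  have e_lim: "e \<longlonglongrightarrow> 0"
    unfolding e_def by (rule LIMSEQ_Suc[OF lim_1_over_n])
  \<comment> \<open>The Gaussian means of the squared transform, with widths \<open>1 / e n\<close> tending to infinity.\<close>
  define g where "g n \<xi> = (norm (fourier u \<xi>))\<^sup>2 * std_normal_density (e n * \<xi>)" for n \<xi>
  have gauss: "integrable lborel (\<lambda>\<xi>. std_normal_density (e n * \<xi>))" for n
    using lborel_integrable_real_affine[of std_normal_density "e n" 0] e_pos[of n] by simp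
  have g_int: "integrable lborel (g n)" for n
  proof (rule Bochner_Integration.integrable_bound)
    show "integrable lborel (\<lambda>\<xi>. (LINT t|lborel. norm (u t))\<^sup>2 * std_normal_density (e n * \<xi>))"
      by (intro integrable_mult_right gauss)
    show "AE \<xi> in lborel. norm (g n \<xi>)
        \<le> norm ((LINT t|lborel. norm (u t))\<^sup>2 * std_normal_density (e n * \<xi>))"
      by (intro AE_I2) (simp add: g_def abs_mult mult_right_mono power_mono norm_fourier_le)
  qed (simp add: g_def[abs_def])

  have "(\<lambda>n. LINT s|lborel. of_real (std_normal_density s) * autocorrelation u (e n * s))
      \<longlonglongrightarrow> (LINT s|lborel. of_real (std_normal_density s) * complex_of_real ?K)"
  proof (rule integral_dominated_convergence[where w="\<lambda>s. std_normal_density s * ?K"])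
    show "AE s in lborel. (\<lambda>n. of_real (std_normal_density s) * autocorrelation u (e n * s))
        \<longlonglongrightarrow> of_real (std_normal_density s) * complex_of_real ?K"
    proof (intro AE_I2 tendsto_mult_left)
      fix s :: real
      show "(\<lambda>n. autocorrelation u (e n * s)) \<longlonglongrightarrow> of_real ?K"
        by (rule autocorrelation_tendsto[OF u2 tendsto_mult_left_zero[OF e_lim]])
    qed
    show "AE s in lborel. norm (of_real (std_normal_density s) * autocorrelation u (e n * s))
        \<le> std_normal_density s * ?K" for n
      by (intro AE_I2) (simp add: norm_mult mult_left_mono norm_autocorrelation_le[OF u2])
  qed simp_all
  also have "(LINT s|lborel. of_real (std_normal_density s) * complex_of_real ?K) = of_real ?K"
  proof -
    have "(LINT s|lborel. of_real (std_normal_density s) * complex_of_real ?K)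
        = of_real (LINT s|lborel. std_normal_density s * ?K)"
      by (simp only: of_real_mult[symmetric] integral_complex_of_real)
    then show ?thesis by simp
  qed
  finally have "(\<lambda>n. of_real (sqrt (2 * pi)) *
      (of_real (sqrt (2 * pi)) * (LINT s|lborel. of_real (std_normal_density s) * autocorrelation u (e n * s))))
      \<longlonglongrightarrow> complex_of_real (sqrt (2 * pi)) * (of_real (sqrt (2 * pi)) * of_real ?K)"
    by (intro tendsto_mult_left)
  moreover have "of_real (sqrt (2 * pi)) *
      (LINT s|lborel. of_real (std_normal_density s) * autocorrelation u (e n * s))
      = complex_of_real (LINT \<xi>|lborel. g n \<xi>)" for n
    by (simp only: g_def integral_complex_of_real[symmetric] gaussian_mean_of_fourier_square[OF u1 e_pos])
  ultimately have "(\<lambda>n. complex_of_real (sqrt (2 * pi) * (LINT \<xi>|lborel. g n \<xi>)))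
      \<longlonglongrightarrow> complex_of_real (sqrt (2 * pi) * (sqrt (2 * pi) * ?K))"
    by (simp only: of_real_mult)
  then have "(\<lambda>n. sqrt (2 * pi) * (LINT \<xi>|lborel. g n \<xi>)) \<longlonglongrightarrow> sqrt (2 * pi) * (sqrt (2 * pi) * ?K)"
    by (rule tendsto_of_real_iff[THEN iffD1])
  then have "(\<lambda>n. ennreal (sqrt (2 * pi) * (LINT \<xi>|lborel. g n \<xi>))) \<longlonglongrightarrow> ennreal (2 * pi * ?K)"
    by (intro tendsto_ennrealI) (simp flip: mult.assoc)
  moreover have "ennreal (sqrt (2 * pi) * (LINT \<xi>|lborel. g n \<xi>))
      = (\<integral>\<^sup>+\<xi>. ennreal ((norm (fourier u \<xi>))\<^sup>2 * exp (- ((e n * \<xi>)\<^sup>2 / 2))) \<partial>lborel)" for n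
  proof -
    have "(\<integral>\<^sup>+\<xi>. ennreal ((norm (fourier u \<xi>))\<^sup>2 * exp (- ((e n * \<xi>)\<^sup>2 / 2))) \<partial>lborel)
        = (\<integral>\<^sup>+\<xi>. ennreal (sqrt (2 * pi) * g n \<xi>) \<partial>lborel)"
      by (intro nn_integral_cong) (simp add: g_def std_normal_density_def)
    also have "\<dots> = ennreal (LINT \<xi>|lborel. sqrt (2 * pi) * g n \<xi>)"
      using integrable_mult_right[OF g_int[of n], of "sqrt (2 * pi)"]
      by (intro nn_integral_eq_integral) (auto simp: g_def)
    finally show ?thesis by simp
  qed
  moreover have "(\<lambda>n. \<integral>\<^sup>+\<xi>. ennreal ((norm (fourier u \<xi>))\<^sup>2 * exp (- ((e n * \<xi>)\<^sup>2 / 2))) \<partial>lborel)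
      \<longlonglongrightarrow> (\<integral>\<^sup>+\<xi>. ennreal ((norm (fourier u \<xi>))\<^sup>2) \<partial>lborel)"
  proof (rule nn_integral_LIMSEQ)
    have "e n \<le> e m" if "m \<le> n" for m n
      using that by (simp add: e_def frac_le)
    then have "(e n * \<xi>)\<^sup>2 \<le> (e m * \<xi>)\<^sup>2" if "m \<le> n" for m n \<xi>
      using that e_pos by (auto simp: power_mult_distrib less_imp_le intro!: mult_right_mono power_mono)
    then show "incseq (\<lambda>n \<xi>. ennreal ((norm (fourier u \<xi>))\<^sup>2 * exp (- ((e n * \<xi>)\<^sup>2 / 2))))"
      by (auto simp: incseq_def le_fun_def intro!: ennreal_leI mult_left_mono)
    fix \<xi> :: real
    have "(\<lambda>n. (norm (fourier u \<xi>))\<^sup>2 * exp (- ((e n * \<xi>)\<^sup>2 / 2)))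
        \<longlonglongrightarrow> (norm (fourier u \<xi>))\<^sup>2 * exp (- ((0 * \<xi>)\<^sup>2 / 2))"
      by (intro tendsto_intros e_lim) simp
    then show "(\<lambda>n. ennreal ((norm (fourier u \<xi>))\<^sup>2 * exp (- ((e n * \<xi>)\<^sup>2 / 2))))
        \<longlonglongrightarrow> ennreal ((norm (fourier u \<xi>))\<^sup>2)"
      by (intro tendsto_ennrealI) simp
  qed measurable
  ultimately have eq: "(\<integral>\<^sup>+\<xi>. ennreal ((norm (fourier u \<xi>))\<^sup>2) \<partial>lborel) = ennreal (2 * pi * ?K)"
    using LIMSEQ_unique by simp
  then show *: "square_integrable lborel (fourier u)"
    by (simp add: square_integrable_iff_finite)
  from eq nn_integral_square[OF *] show "(LINT \<xi>|lborel. (norm (fourier u \<xi>))\<^sup>2) = 2 * pi * ?K"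
    using K by (simp add: integral_nonneg_AE)
qed

lemma fourier_add:
  assumes "integrable lborel u" "integrable lborel v"
  shows "fourier (\<lambda>x. u x + v x) \<xi> = fourier u \<xi> + fourier v \<xi>"
  unfolding fourier_def distrib_right
  by (intro Bochner_Integration.integral_add fourier_integrand assms)

lemma fourier_cmult: "fourier (\<lambda>x. c * u x) \<xi> = c * fourier u \<xi>"
  unfolding fourier_def mult.assoc by simp

corollary Parseval:
  assumes u: "integrable lborel u" "square_integrable lborel u"
    and v: "integrable lborel v" "square_integrable lborel v"
  shows "(LINT \<xi>|lborel. fourier u \<xi> * cnj (fourier v \<xi>))
      = of_real (2 * pi) * (LINT x|lborel. u x * cnj (v x))"
proof (rule isometry_preserves_inner[OF u(2) v(2) Plancherel(1)[OF u] Plancherel(1)[OF v]])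
  fix c :: complex
  show "(LINT \<xi>|lborel. (norm (fourier u \<xi> + c * fourier v \<xi>))\<^sup>2)
      = 2 * pi * (LINT x|lborel. (norm (u x + c * v x))\<^sup>2)"
    using Plancherel(2)[OF Bochner_Integration.integrable_add[OF u(1) integrable_mult_right[OF v(1)]]
        square_integrable_add[OF u(2) square_integrable_cmult[OF v(2)]], of c]
    by (simp add: fourier_add fourier_cmult u v)
qed

section \<open>Correlations of square integrable functions\<close>

text \<open>\<open>H\<close> is the Plancherel transform of \<open>h\<close>, expressed by testing against \<open>L\<^sup>1 \<inter> L\<^sup>2\<close>, where
  the transform is an integral. In this form a translation and dilation of \<open>h\<close> can be moved to the
  test function.\<close>

definition weak_fourier :: "(real \<Rightarrow> complex) \<Rightarrow> (real \<Rightarrow> complex) \<Rightarrow> bool" where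
  "weak_fourier h H \<longleftrightarrow> square_integrable lborel h \<and> square_integrable lborel H \<and>
     (\<forall>g. integrable lborel g \<longrightarrow> square_integrable lborel g \<longrightarrow>
        (LINT \<xi>|lborel. H \<xi> * cnj (fourier g \<xi>)) = of_real (2 * pi) * (LINT t|lborel. h t * cnj (g t)))"

lemma weak_fourier_of_limit:
  fixes h H :: "real \<Rightarrow> complex"
  assumes h: "square_integrable lborel h" and H: "square_integrable lborel H"
    and lim: "(\<lambda>n. LINT \<xi>|lborel. (norm (fourier (cutoff n h) \<xi> - H \<xi>))\<^sup>2) \<longlonglongrightarrow> 0"
  shows "weak_fourier h H"
  unfolding weak_fourier_def
proof (intro conjI h H allI impI)
  fix g :: "real \<Rightarrow> complex"
  assume g: "integrable lborel g" "square_integrable lborel g"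
  note ch = integrable_cutoff[OF h] square_integrable_cutoff[OF h]
  have "(\<lambda>n. LINT \<xi>|lborel. fourier (cutoff n h) \<xi> * cnj (fourier g \<xi>))
      \<longlonglongrightarrow> (LINT \<xi>|lborel. H \<xi> * cnj (fourier g \<xi>))"
    by (rule square_integrable_inner_tendsto[OF H Plancherel(1)[OF ch] lim
          square_integrable_cnj[OF Plancherel(1)[OF g]]])
  moreover have "(\<lambda>n. LINT \<xi>|lborel. fourier (cutoff n h) \<xi> * cnj (fourier g \<xi>))
      \<longlonglongrightarrow> of_real (2 * pi) * (LINT t|lborel. h t * cnj (g t))"
    unfolding Parseval[OF ch g]
    by (rule tendsto_mult_left[OF square_integrable_inner_tendsto[OF h ch(2) cutoff_tendsto_L2[OF h]
          square_integrable_cnj[OF g(2)]]])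
  ultimately show "(LINT \<xi>|lborel. H \<xi> * cnj (fourier g \<xi>))
      = of_real (2 * pi) * (LINT t|lborel. h t * cnj (g t))"
    by (rule LIMSEQ_unique)
qed

lemma square_integrable_affine:
  fixes u :: "real \<Rightarrow> complex"
  assumes u: "square_integrable lborel u" and c: "c \<noteq> 0"
  shows "square_integrable lborel (\<lambda>x. u (t + c * x))"
proof -
  note [measurable] = square_integrable_measurable[OF u]
  have "(\<lambda>x. u (t + c * x)) \<in> borel_measurable lborel" by measurable
  then show ?thesis
    using lborel_integrable_real_affine[OF square_integrable_integrable[OF u] c, of t]
    by (simp add: square_integrable_def)
qed

lemma fourier_affine:
  assumes a: "a > 0"
  shows "fourier (\<lambda>x. g (b + a * x)) (a * \<xi>) = of_real (1 / a) * (cis (\<xi> * b) * fourier g \<xi>)"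
proof -
  have "fourier g \<xi> = a *\<^sub>R (LINT x|lborel. g (b + a * x) * cis (- (\<xi> * (b + a * x))))"
    unfolding fourier_def using a by (subst lborel_integral_real_affine[of a _ b]) simp_all
  also have "(LINT x|lborel. g (b + a * x) * cis (- (\<xi> * (b + a * x))))
      = (LINT x|lborel. cis (- (\<xi> * b)) * (g (b + a * x) * cis (- (a * \<xi> * x))))"
  proof (rule Bochner_Integration.integral_cong[OF refl])
    fix x
    have "cis (- (\<xi> * (b + a * x))) = cis (- (\<xi> * b)) * cis (- (a * \<xi> * x))"
      by (simp add: cis_mult algebra_simps)
    then show "g (b + a * x) * cis (- (\<xi> * (b + a * x)))
        = cis (- (\<xi> * b)) * (g (b + a * x) * cis (- (a * \<xi> * x)))"
      by simp
  qed
  also have "\<dots> = cis (- (\<xi> * b)) * fourier (\<lambda>x. g (b + a * x)) (a * \<xi>)"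
    by (simp add: fourier_def)
  finally have "cis (\<xi> * b) * fourier g \<xi>
      = of_real a * ((cis (\<xi> * b) * cis (- (\<xi> * b))) * fourier (\<lambda>x. g (b + a * x)) (a * \<xi>))"
    by (simp add: scaleR_conv_of_real)
  then show ?thesis
    using a by (simp add: cis_mult)
qed

text \<open>The substitution \<open>s = b + a x\<close> turns the correlation into an inner product of \<open>\<psi>\<close> with
  \<open>g (b + a x)\<close>. Its transform contributes the factor \<open>cis (\<xi> b)\<close>, which makes the inner product on
  the frequency side a Fourier integral in \<open>b\<close>.\<close>

lemma correlation_eq_fourier:
  assumes \<psi>: "weak_fourier \<psi> \<Psi>" and g: "integrable lborel g" "square_integrable lborel g"
    and a: "a > 0"
  shows "(LINT s|lborel. g s * cnj (\<psi> ((s - b) / a)))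
      = of_real (a / (2 * pi)) * fourier (\<lambda>\<xi>. fourier g \<xi> * cnj (\<Psi> (a * \<xi>))) (- b)"
proof -
  let ?g = "\<lambda>x. g (b + a * x)"
  have g': "integrable lborel ?g" "square_integrable lborel ?g"
    using lborel_integrable_real_affine[OF g(1), of a b] square_integrable_affine[OF g(2), of a b] a
    by auto
  have "(LINT s|lborel. g s * cnj (\<psi> ((s - b) / a))) = a *\<^sub>R (LINT x|lborel. ?g x * cnj (\<psi> x))"
    using a by (subst lborel_integral_real_affine[of a _ b]) simp_all
  also have "(LINT x|lborel. ?g x * cnj (\<psi> x)) = cnj (LINT x|lborel. \<psi> x * cnj (?g x))"
    by (subst Bochner_Integration.integral_cnj[symmetric]) (simp add: mult.commute)
  also have "(LINT x|lborel. \<psi> x * cnj (?g x))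
      = of_real (1 / (2 * pi)) * (LINT \<xi>|lborel. \<Psi> \<xi> * cnj (fourier ?g \<xi>))"
    using \<psi> g' by (simp add: weak_fourier_def)
  also have "(LINT \<xi>|lborel. \<Psi> \<xi> * cnj (fourier ?g \<xi>))
      = a *\<^sub>R (LINT \<xi>|lborel. \<Psi> (a * \<xi>) * cnj (fourier ?g (a * \<xi>)))"
    using a by (subst lborel_integral_real_affine[of a _ 0]) simp_all
  also have "(LINT \<xi>|lborel. \<Psi> (a * \<xi>) * cnj (fourier ?g (a * \<xi>)))
      = (LINT \<xi>|lborel. of_real (1 / a) * cnj (fourier g \<xi> * cnj (\<Psi> (a * \<xi>)) * cis (- (- b * \<xi>))))"
    unfolding fourier_affine[OF a] by (simp add: ac_simps)
  also have "\<dots> = of_real (1 / a) * cnj (fourier (\<lambda>\<xi>. fourier g \<xi> * cnj (\<Psi> (a * \<xi>))) (- b))"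
    unfolding integral_mult_right_zero Bochner_Integration.integral_cnj fourier_def ..
  finally show ?thesis
    using a by (simp add: scaleR_conv_of_real)
qed

text \<open>The product of the two transforms is integrable by Cauchy-Schwarz; the finiteness assumption
  makes it square integrable too, so Plancherel's theorem applies to it. This computes the energy
  of the wavelet coefficients at a single scale \<open>a\<close>.\<close>

lemma correlation_Plancherel:
  assumes \<psi>: "weak_fourier \<psi> \<Psi>" and g: "integrable lborel g" "square_integrable lborel g"
    and a: "a > 0"
    and k: "(\<integral>\<^sup>+\<xi>. ennreal ((norm (fourier g \<xi> * cnj (\<Psi> (a * \<xi>))))\<^sup>2) \<partial>lborel) < \<infinity>"
  shows "(\<integral>\<^sup>+b. ennreal ((norm (LINT s|lborel. g s * cnj (\<psi> ((s - b) / a))))\<^sup>2) \<partial>lborel)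
      = ennreal (a\<^sup>2 / (2 * pi)) *
        (\<integral>\<^sup>+\<xi>. ennreal ((norm (fourier g \<xi> * cnj (\<Psi> (a * \<xi>))))\<^sup>2) \<partial>lborel)"
proof -
  let ?k = "\<lambda>\<xi>. fourier g \<xi> * cnj (\<Psi> (a * \<xi>))"
  have \<Psi>: "square_integrable lborel (\<lambda>\<xi>. \<Psi> (a * \<xi>))"
    using \<psi> a square_integrable_affine[of \<Psi> a 0] by (simp add: weak_fourier_def)
  have k1: "integrable lborel ?k"
    by (rule square_integrable_mult_integrable[OF Plancherel(1)[OF g] square_integrable_cnj[OF \<Psi>]])
  then have k2: "square_integrable lborel ?k"
    using k borel_measurable_integrable[OF k1] by (simp add: square_integrable_iff_finite)
  note [measurable] = borel_measurable_integrable[OF k1]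
  have "(\<integral>\<^sup>+b. ennreal ((norm (LINT s|lborel. g s * cnj (\<psi> ((s - b) / a))))\<^sup>2) \<partial>lborel)
      = (\<integral>\<^sup>+b. ennreal ((a / (2 * pi))\<^sup>2) * ennreal ((norm (fourier ?k (- b)))\<^sup>2) \<partial>lborel)"
    unfolding correlation_eq_fourier[OF \<psi> g a]
    by (simp add: norm_mult norm_divide power_mult_distrib power_divide flip: ennreal_mult)
  also have "\<dots> = ennreal ((a / (2 * pi))\<^sup>2) * (\<integral>\<^sup>+b. ennreal ((norm (fourier ?k (- b)))\<^sup>2) \<partial>lborel)"
    by (rule nn_integral_cmult) measurable
  also have "(\<integral>\<^sup>+b. ennreal ((norm (fourier ?k (- b)))\<^sup>2) \<partial>lborel)
      = (\<integral>\<^sup>+b. ennreal ((norm (fourier ?k b))\<^sup>2) \<partial>lborel)"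
    using nn_integral_real_affine[of "\<lambda>b. ennreal ((norm (fourier ?k b))\<^sup>2)" "-1" 0] by simp
  also have "\<dots> = ennreal (2 * pi) * (\<integral>\<^sup>+\<xi>. ennreal ((norm (?k \<xi>))\<^sup>2) \<partial>lborel)"
    unfolding nn_integral_square[OF Plancherel(1)[OF k1 k2]] nn_integral_square[OF k2]
      Plancherel(2)[OF k1 k2] by (simp add: ennreal_mult integral_nonneg_AE)
  also have "ennreal ((a / (2 * pi))\<^sup>2) * (ennreal (2 * pi) * (\<integral>\<^sup>+\<xi>. ennreal ((norm (?k \<xi>))\<^sup>2) \<partial>lborel))
      = ennreal (a\<^sup>2 / (2 * pi)) * (\<integral>\<^sup>+\<xi>. ennreal ((norm (?k \<xi>))\<^sup>2) \<partial>lborel)"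
    unfolding mult.assoc[symmetric]
    by (subst ennreal_mult[symmetric]) (simp_all add: power2_eq_square)
  finally show ?thesis .
qed

section \<open>Tight frames indexed by a measure space\<close>

text \<open>Fatou's lemma for a pointwise limit.\<close>

lemma nn_integral_le_of_tendsto:
  fixes u :: "nat \<Rightarrow> 'a \<Rightarrow> ennreal"
  assumes meas: "\<And>n. u n \<in> borel_measurable M"
    and lim: "\<And>x. x \<in> space M \<Longrightarrow> (\<lambda>n. u n x) \<longlonglongrightarrow> f x"
    and le: "\<And>n. (\<integral>\<^sup>+x. u n x \<partial>M) \<le> c"
  shows "(\<integral>\<^sup>+x. f x \<partial>M) \<le> c"
proof -
  have "(\<integral>\<^sup>+x. f x \<partial>M) = (\<integral>\<^sup>+x. liminf (\<lambda>n. u n x) \<partial>M)"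
    by (intro nn_integral_cong lim_imp_Liminf[symmetric] lim) auto
  also have "\<dots> \<le> liminf (\<lambda>n. \<integral>\<^sup>+x. u n x \<partial>M)"
    by (rule nn_integral_liminf[OF meas])
  also have "\<dots> \<le> c"
    by (rule Liminf_le) (use le in auto)
  finally show ?thesis .
qed

text \<open>A continuous tight frame with bound \<open>C\<close>: up to this factor, \<open>f\<close> has the same energy as its
  coefficients. The isometry is required on \<open>L\<^sup>1 \<inter> L\<^sup>2\<close>, where it can be checked with Fourier
  integrals; it extends to \<open>L\<^sup>2\<close> by density.\<close>

locale tight_frame = sigma_finite_measure N for N :: "'x measure" +
  fixes \<phi> :: "'x \<Rightarrow> real \<Rightarrow> complex" and C :: real
  assumes frame_measurable: "case_prod \<phi> \<in> borel_measurable (N \<Otimes>\<^sub>M lborel)"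
    and frame_square_integrable: "\<And>x. x \<in> space N \<Longrightarrow> square_integrable lborel (\<phi> x)"
    and bound_nonneg: "0 \<le> C"
    and isometry_dense: "\<And>f. integrable lborel f \<Longrightarrow> square_integrable lborel f \<Longrightarrow>
      (\<integral>\<^sup>+x. ennreal ((norm (LINT t|lborel. f t * cnj (\<phi> x t)))\<^sup>2) \<partial>N)
        = ennreal C * (\<integral>\<^sup>+t. ennreal ((norm (f t))\<^sup>2) \<partial>lborel)"
begin

definition coef :: "(real \<Rightarrow> complex) \<Rightarrow> 'x \<Rightarrow> complex" where
  "coef f x = (LINT t|lborel. f t * cnj (\<phi> x t))"

lemma frame_measurable_pair [measurable]: "(\<lambda>p. \<phi> (fst p) (snd p)) \<in> borel_measurable (N \<Otimes>\<^sub>M lborel)"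
  using frame_measurable by (simp add: case_prod_unfold)

lemma frame_section_measurable [measurable]: "(\<lambda>x. \<phi> x t) \<in> borel_measurable N"
proof -
  have "(\<lambda>x. (\<lambda>p. \<phi> (fst p) (snd p)) (x, t)) \<in> borel_measurable N"
    by measurable
  then show ?thesis by simp
qed

lemma coef_measurable:
  assumes "square_integrable lborel f"
  shows "coef f \<in> borel_measurable N"
proof -
  note [measurable] = square_integrable_measurable[OF assms]
  have "(\<lambda>(x, t). f t * cnj (\<phi> x t)) \<in> borel_measurable (N \<Otimes>\<^sub>M lborel)"
    unfolding case_prod_unfold by measurable
  from lborel.borel_measurable_lebesgue_integral[OF this] show ?thesis
    by (simp add: coef_def[abs_def])
qed

lemma coef_integrand:
  "square_integrable lborel f \<Longrightarrow> x \<in> space N \<Longrightarrow> integrable lborel (\<lambda>t. f t * cnj (\<phi> x t))"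
  by (intro square_integrable_mult_integrable square_integrable_cnj frame_square_integrable)

lemma coef_linear:
  assumes "square_integrable lborel f" "square_integrable lborel g" "x \<in> space N"
  shows "coef (\<lambda>t. f t + c * g t) x = coef f x + c * coef g x"
  using coef_integrand[OF assms(1,3)] coef_integrand[OF assms(2,3)]
  by (simp add: coef_def distrib_right mult.assoc)

lemma coef_tendsto:
  assumes "square_integrable lborel f" "x \<in> space N"
  shows "(\<lambda>n. coef (cutoff n f) x) \<longlonglongrightarrow> coef f x"
  unfolding coef_def
  by (rule square_integrable_inner_tendsto[OF assms(1) square_integrable_cutoff[OF assms(1)]
        cutoff_tendsto_L2[OF assms(1)] square_integrable_cnj[OF frame_square_integrable[OF assms(2)]]])

text \<open>The coefficients of the cutoffs of \<open>f\<close> converge at every index, so Fatou's lemma carries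
  the upper half of the isometry over to \<open>L\<^sup>2\<close>.\<close>

lemma coef_norm_le:
  assumes f: "square_integrable lborel f"
  shows "(\<integral>\<^sup>+x. ennreal ((norm (coef f x))\<^sup>2) \<partial>N)
      \<le> ennreal C * (\<integral>\<^sup>+t. ennreal ((norm (f t))\<^sup>2) \<partial>lborel)"
proof (rule nn_integral_le_of_tendsto)
  fix n
  show "(\<lambda>x. ennreal ((norm (coef (cutoff n f) x))\<^sup>2)) \<in> borel_measurable N"
    using coef_measurable[OF square_integrable_cutoff[OF f]] by measurable
  show "(\<integral>\<^sup>+x. ennreal ((norm (coef (cutoff n f) x))\<^sup>2) \<partial>N)
      \<le> ennreal C * (\<integral>\<^sup>+t. ennreal ((norm (f t))\<^sup>2) \<partial>lborel)"
    unfolding coef_def isometry_dense[OF integrable_cutoff[OF f] square_integrable_cutoff[OF f]]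
    by (intro mult_left_mono nn_integral_mono ennreal_leI power_mono norm_cutoff_le) auto
next
  fix x assume "x \<in> space N"
  from coef_tendsto[OF f this]
  show "(\<lambda>n. ennreal ((norm (coef (cutoff n f) x))\<^sup>2)) \<longlonglongrightarrow> ennreal ((norm (coef f x))\<^sup>2)"
    by (intro tendsto_ennrealI tendsto_power tendsto_norm)
qed

lemma square_integrable_coef:
  assumes f: "square_integrable lborel f"
  shows "square_integrable N (coef f)"
proof -
  have "ennreal C * (\<integral>\<^sup>+t. ennreal ((norm (f t))\<^sup>2) \<partial>lborel) < \<infinity>"
    unfolding nn_integral_square[OF f] by (simp flip: ennreal_mult' add: bound_nonneg)
  then show ?thesis
    using coef_norm_le[OF f] coef_measurable[OF f]
    by (auto simp: square_integrable_iff_finite intro: le_less_trans)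
qed

lemma coef_norm_square_le:
  assumes f: "square_integrable lborel f"
  shows "(LINT x|N. (norm (coef f x))\<^sup>2) \<le> C * (LINT t|lborel. (norm (f t))\<^sup>2)"
  using coef_norm_le[OF f]
  unfolding nn_integral_square[OF f] nn_integral_square[OF square_integrable_coef[OF f]]
  by (simp add: bound_nonneg integral_nonneg_AE flip: ennreal_mult)

lemma coef_inner_dense:
  assumes f: "integrable lborel f" "square_integrable lborel f"
    and h: "integrable lborel h" "square_integrable lborel h"
  shows "(LINT x|N. coef f x * cnj (coef h x)) = of_real C * (LINT t|lborel. f t * cnj (h t))"
proof (rule isometry_preserves_inner[OF f(2) h(2) square_integrable_coef[OF f(2)] square_integrable_coef[OF h(2)]])
  fix c :: complex
  let ?g = "\<lambda>t. f t + c * h t"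
  have g: "integrable lborel ?g" "square_integrable lborel ?g"
    using f h by (auto intro: square_integrable_add square_integrable_cmult)
  have "(LINT x|N. (norm (coef f x + c * coef h x))\<^sup>2) = (LINT x|N. (norm (coef ?g x))\<^sup>2)"
    by (intro Bochner_Integration.integral_cong) (simp_all add: coef_linear[OF f(2) h(2)])
  also have "\<dots> = C * (LINT t|lborel. (norm (?g t))\<^sup>2)"
    using isometry_dense[OF g, folded coef_def]
    unfolding nn_integral_square[OF g(2)] nn_integral_square[OF square_integrable_coef[OF g(2)]]
    by (simp add: bound_nonneg integral_nonneg_AE flip: ennreal_mult)
  finally show "(LINT x|N. (norm (coef f x + c * coef h x))\<^sup>2)
      = C * (LINT t|lborel. (norm (f t + c * h t))\<^sup>2)" .
qed

text \<open>By \<open>coef_norm_le\<close> the coefficients of the cutoffs of \<open>f\<close> converge in \<open>L\<^sup>2\<close> as well, and both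
  sides are continuous in \<open>f\<close>.\<close>

lemma coef_inner:
  assumes f: "square_integrable lborel f"
    and h: "integrable lborel h" "square_integrable lborel h"
  shows "(LINT x|N. coef f x * cnj (coef h x)) = of_real C * (LINT t|lborel. f t * cnj (h t))"
proof -
  note fn = integrable_cutoff[OF f] square_integrable_cutoff[OF f]
  have le: "norm (LINT x|N. (norm (coef (cutoff n f) x - coef f x))\<^sup>2)
      \<le> C * (LINT t|lborel. (norm (cutoff n f t - f t))\<^sup>2)" for n
  proof -
    have "(LINT x|N. (norm (coef (cutoff n f) x - coef f x))\<^sup>2)
        = (LINT x|N. (norm (coef (\<lambda>t. cutoff n f t + (-1) * f t) x))\<^sup>2)"
      by (intro Bochner_Integration.integral_cong) (simp_all only: coef_linear[OF fn(2) f], simp)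
    also have "\<dots> \<le> C * (LINT t|lborel. (norm (cutoff n f t - f t))\<^sup>2)"
      using coef_norm_square_le[OF square_integrable_diff[OF fn(2) f], of n] by simp
    finally show ?thesis by (simp add: integral_nonneg_AE)
  qed
  have "(\<lambda>n. LINT x|N. (norm (coef (cutoff n f) x - coef f x))\<^sup>2) \<longlonglongrightarrow> 0"
    by (rule Lim_null_comparison[OF always_eventually[OF allI[OF le]]
          tendsto_mult_right_zero[OF cutoff_tendsto_L2[OF f]]])
  then have "(\<lambda>n. LINT x|N. coef (cutoff n f) x * cnj (coef h x)) \<longlonglongrightarrow> (LINT x|N. coef f x * cnj (coef h x))"
    by (rule square_integrable_inner_tendsto[OF square_integrable_coef[OF f] square_integrable_coef[OF fn(2)]
          _ square_integrable_cnj[OF square_integrable_coef[OF h(2)]]])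
  moreover have "(\<lambda>n. LINT x|N. coef (cutoff n f) x * cnj (coef h x))
      \<longlonglongrightarrow> of_real C * (LINT t|lborel. f t * cnj (h t))"
    unfolding coef_inner_dense[OF fn h]
    by (rule tendsto_mult_left[OF square_integrable_inner_tendsto[OF f fn(2) cutoff_tendsto_L2[OF f]
          square_integrable_cnj[OF h(2)]]])
  ultimately show ?thesis
    by (rule LIMSEQ_unique)
qed

definition partial_synthesis :: "'x set \<Rightarrow> (real \<Rightarrow> complex) \<Rightarrow> real \<Rightarrow> complex" where
  "partial_synthesis E f t = (LINT x:E|N. coef f x * \<phi> x t)"

text \<open>On the index set \<open>E\<close> the frame has energy at most \<open>K\<close> at every point \<open>t\<close>. Together with
  the square integrability of the coefficients this makes the synthesis integral over \<open>E\<close> absolutely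
  convergent at every \<open>t\<close> and bounded in \<open>t\<close>.\<close>

context
  fixes E :: "'x set" and K :: real and f :: "real \<Rightarrow> complex"
  assumes E: "E \<in> sets N"
    and K: "\<And>t. (\<integral>\<^sup>+x\<in>E. ennreal ((norm (\<phi> x t))\<^sup>2) \<partial>N) \<le> ennreal K"
    and f: "square_integrable lborel f"
begin

lemma square_integrable_restricted_coef: "square_integrable N (\<lambda>x. indicator E x *\<^sub>R coef f x)"
  using E coef_measurable[OF f]
  by (intro square_integrable_bound[OF square_integrable_coef[OF f], of _ 1]) (auto simp: indicator_def)

lemma square_integrable_restricted_frame: "square_integrable N (\<lambda>x. indicator E x *\<^sub>R \<phi> x t)"
proof -
  note [measurable] = E
  have "(\<integral>\<^sup>+x. ennreal ((norm (indicator E x *\<^sub>R \<phi> x t))\<^sup>2) \<partial>N)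
      = (\<integral>\<^sup>+x\<in>E. ennreal ((norm (\<phi> x t))\<^sup>2) \<partial>N)"
    by (intro nn_integral_cong) (auto simp: indicator_def)
  also have "\<dots> < \<infinity>"
    using K[of t] by (rule le_less_trans) simp
  finally show ?thesis
    by (simp add: square_integrable_iff_finite)
qed

lemma restricted_product:
  "indicator E x *\<^sub>R (coef f x * \<phi> x t) = (indicator E x *\<^sub>R coef f x) * (indicator E x *\<^sub>R \<phi> x t)"
  by (simp add: indicator_def)

lemma partial_synthesis_set_integrable: "set_integrable N E (\<lambda>x. coef f x * \<phi> x t)"
  unfolding set_integrable_def restricted_product
  by (rule square_integrable_mult_integrable[OF square_integrable_restricted_coef
        square_integrable_restricted_frame])

lemma partial_synthesis_absolute_bound:
  "(LINT x|N. norm (indicator E x *\<^sub>R (coef f x * \<phi> x t)))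
     \<le> sqrt ((LINT x|N. (norm (coef f x))\<^sup>2) * max 0 K)"
proof (rule real_le_rsqrt)
  have "(LINT x|N. (norm (indicator E x *\<^sub>R \<phi> x t))\<^sup>2) \<le> max 0 K"
  proof -
    have "ennreal (LINT x|N. (norm (indicator E x *\<^sub>R \<phi> x t))\<^sup>2)
        = (\<integral>\<^sup>+x\<in>E. ennreal ((norm (\<phi> x t))\<^sup>2) \<partial>N)"
      unfolding nn_integral_square[OF square_integrable_restricted_frame, symmetric]
      by (intro nn_integral_cong) (auto simp: indicator_def)
    also have "\<dots> \<le> ennreal (max 0 K)"
      using K[of t] by (rule order_trans) (simp add: ennreal_leI)
    finally show ?thesis by (simp add: ennreal_le_iff)
  qed
  moreover have "(LINT x|N. (norm (indicator E x *\<^sub>R coef f x))\<^sup>2) \<le> (LINT x|N. (norm (coef f x))\<^sup>2)"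
    using square_integrable_integrable[OF square_integrable_restricted_coef]
      square_integrable_integrable[OF square_integrable_coef[OF f]]
    by (rule integral_mono) (auto simp: indicator_def)
  ultimately have "(LINT x|N. (norm (indicator E x *\<^sub>R coef f x))\<^sup>2) * (LINT x|N. (norm (indicator E x *\<^sub>R \<phi> x t))\<^sup>2)
      \<le> (LINT x|N. (norm (coef f x))\<^sup>2) * max 0 K"
    by (intro mult_mono) (auto simp: integral_nonneg_AE)
  then show "(LINT x|N. norm (indicator E x *\<^sub>R (coef f x * \<phi> x t)))\<^sup>2
      \<le> (LINT x|N. (norm (coef f x))\<^sup>2) * max 0 K"
    unfolding restricted_product
    using square_integrable_Cauchy_Schwarz[OF square_integrable_restricted_coef square_integrable_restricted_frame, of t]
    by (rule order_trans[rotated])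
qed

lemma synthesis_integrand_measurable:
  "(\<lambda>(t, x). indicator E x *\<^sub>R (coef f x * \<phi> x t)) \<in> borel_measurable (lborel \<Otimes>\<^sub>M N)"
proof -
  note [measurable] = E coef_measurable[OF f]
  have "(\<lambda>p. indicator E (fst p) *\<^sub>R (coef f (fst p) * \<phi> (fst p) (snd p))) \<in> borel_measurable (N \<Otimes>\<^sub>M lborel)"
    by measurable
  from measurable_compose[OF measurable_pair_swap' this] show ?thesis
    by (simp add: case_prod_unfold)
qed

lemma partial_synthesis_measurable: "partial_synthesis E f \<in> borel_measurable lborel"
  using borel_measurable_lebesgue_integral[OF synthesis_integrand_measurable]
  by (simp add: partial_synthesis_def[abs_def] set_lebesgue_integral_def)

lemma norm_partial_synthesis_le:
  "norm (partial_synthesis E f t) \<le> sqrt ((LINT x|N. (norm (coef f x))\<^sup>2) * max 0 K)"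
  unfolding partial_synthesis_def set_lebesgue_integral_def
  using integral_norm_bound partial_synthesis_absolute_bound by (rule order_trans)

text \<open>Fubini applies because the absolute synthesis integral is bounded in \<open>t\<close> and \<open>h\<close> is
  integrable.\<close>

lemma partial_synthesis_inner:
  assumes h: "integrable lborel h" "square_integrable lborel h"
  shows "(LINT t|lborel. partial_synthesis E f t * cnj (h t))
      = (LINT x|N. (indicator E x *\<^sub>R coef f x) * cnj (coef h x))"
proof -
  note sf = borel_measurable_lebesgue_integral
  interpret pair_sigma_finite lborel N ..
  let ?B = "sqrt ((LINT x|N. (norm (coef f x))\<^sup>2) * max 0 K)"
  let ?F = "\<lambda>t x. indicator E x *\<^sub>R (coef f x * \<phi> x t) * cnj (h t)"
  note [measurable] = borel_measurable_integrable[OF h(1)]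
  have meas: "(\<lambda>(t, x). ?F t x) \<in> borel_measurable (lborel \<Otimes>\<^sub>M N)"
    using synthesis_integrand_measurable unfolding case_prod_unfold by measurable
  have int: "integrable (lborel \<Otimes>\<^sub>M N) (\<lambda>(t, x). ?F t x)"
  proof (rule Fubini_integrable[OF meas])
    show "AE t in lborel. integrable N (\<lambda>x. case (t, x) of (t, x) \<Rightarrow> ?F t x)"
    proof (rule AE_I2)
      fix t
      show "integrable N (\<lambda>x. case (t, x) of (t, x) \<Rightarrow> ?F t x)"
        unfolding prod.case
        by (rule integrable_mult_left[OF partial_synthesis_set_integrable[unfolded set_integrable_def]])
    qed
    show "integrable lborel (\<lambda>t. LINT x|N. norm (case (t, x) of (t, x) \<Rightarrow> ?F t x))"
    proof (rule Bochner_Integration.integrable_bound)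
      show "integrable lborel (\<lambda>t. ?B * norm (h t))"
        using h by simp
      have "case_prod (\<lambda>t x. norm (case (t, x) of (t, x) \<Rightarrow> ?F t x)) \<in> borel_measurable (lborel \<Otimes>\<^sub>M N)"
        using measurable_compose[OF meas borel_measurable_norm] by (simp only: case_prod_unfold fst_conv snd_conv)
      then show "(\<lambda>t. LINT x|N. norm (case (t, x) of (t, x) \<Rightarrow> ?F t x)) \<in> borel_measurable lborel"
        by (rule sf)
      show "AE t in lborel. norm (LINT x|N. norm (case (t, x) of (t, x) \<Rightarrow> ?F t x)) \<le> norm (?B * norm (h t))"
      proof (rule AE_I2)
        fix t
        have "(LINT x|N. norm (?F t x)) = (LINT x|N. norm (indicator E x *\<^sub>R (coef f x * \<phi> x t))) * norm (h t)"
          unfolding norm_mult complex_mod_cnj by (rule integral_mult_left_zero)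
        then show "norm (LINT x|N. norm (case (t, x) of (t, x) \<Rightarrow> ?F t x)) \<le> norm (?B * norm (h t))"
          using mult_right_mono[OF partial_synthesis_absolute_bound[of t] norm_ge_zero[of "h t"]]
          by (simp add: integral_nonneg_AE abs_mult)
      qed
    qed
  qed
  have "(LINT t|lborel. partial_synthesis E f t * cnj (h t)) = (LINT t|lborel. LINT x|N. ?F t x)"
    unfolding partial_synthesis_def set_lebesgue_integral_def by (simp only: integral_mult_left_zero)
  also have "\<dots> = (LINT x|N. LINT t|lborel. ?F t x)"
    by (rule Fubini_integral[OF int, symmetric])
  also have "\<dots> = (LINT x|N. (indicator E x *\<^sub>R coef f x) * cnj (coef h x))"
  proof (rule Bochner_Integration.integral_cong[OF refl])
    fix x
    have "(LINT t|lborel. ?F t x) = (LINT t|lborel. (indicator E x *\<^sub>R coef f x) * cnj (h t * cnj (\<phi> x t)))"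
      by (simp add: scaleR_conv_of_real ac_simps)
    also have "\<dots> = (indicator E x *\<^sub>R coef f x) * cnj (coef h x)"
      unfolding coef_def integral_mult_right_zero Bochner_Integration.integral_cnj ..
    finally show "(LINT t|lborel. ?F t x) = (indicator E x *\<^sub>R coef f x) * cnj (coef h x)" .
  qed
  finally show ?thesis .
qed

text \<open>Duality: by \<open>coef_inner\<close> and \<open>partial_synthesis_inner\<close>, the inner product of the error
  \<open>C f - partial_synthesis E f\<close> with \<open>h\<close> is the inner product of the coefficients of \<open>f\<close> and of \<open>h\<close>
  outside \<open>E\<close>. Taking for \<open>h\<close> a cutoff of the error itself, Cauchy-Schwarz bounds \<open>\<parallel>h\<parallel>\<^sup>4\<close> by
  \<open>C \<parallel>h\<parallel>\<^sup>2\<close> times the energy of the coefficients outside \<open>E\<close>; one factor \<open>\<parallel>h\<parallel>\<^sup>2\<close> cancels.\<close>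

theorem partial_synthesis_error:
  "(\<integral>\<^sup>+t. ennreal ((norm (of_real C * f t - partial_synthesis E f t))\<^sup>2) \<partial>lborel)
     \<le> ennreal (C * (LINT x|N. (norm (indicator (- E) x *\<^sub>R coef f x))\<^sup>2))"
proof -
  let ?J = "partial_synthesis E f"
  let ?T = "LINT x|N. (norm (indicator (- E) x *\<^sub>R coef f x))\<^sup>2"
  let ?d = "\<lambda>t. of_real C * f t - ?J t"
  note [measurable] = E square_integrable_measurable[OF f] partial_synthesis_measurable coef_measurable[OF f]
  have rest: "square_integrable N (\<lambda>x. indicator (- E) x *\<^sub>R coef f x)"
  proof (rule square_integrable_bound[OF square_integrable_coef[OF f], of _ 1])
    have "(\<lambda>x. coef f x - indicator E x *\<^sub>R coef f x) \<in> borel_measurable N" by measurable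
    moreover have "coef f x - indicator E x *\<^sub>R coef f x = indicator (- E) x *\<^sub>R coef f x" for x
      by (simp add: indicator_def)
    ultimately show "(\<lambda>x. indicator (- E) x *\<^sub>R coef f x) \<in> borel_measurable N" by simp
  qed (simp add: indicator_def)
  have cut: "(\<integral>\<^sup>+t. ennreal ((norm (cutoff m ?d t))\<^sup>2) \<partial>lborel) \<le> ennreal (C * ?T)" for m
  proof -
    let ?h = "cutoff m ?d"
    have J: "square_integrable lborel (cutoff m ?J)"
      by (rule square_integrable_cutoff_bounded[OF _ norm_partial_synthesis_le]) measurable
    have "?h = (\<lambda>t. of_real C * cutoff m f t - cutoff m ?J t)"
      by (auto simp: cutoff_def scaleR_diff_right)
    then have h2: "square_integrable lborel ?h"
      using square_integrable_diff[OF square_integrable_cmult[OF square_integrable_cutoff[OF f]] J] by simp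
    \<comment> \<open>A cutoff is its own cutoff, so square integrability of \<open>h\<close> yields integrability.\<close>
    have "cutoff m ?h = ?h"
      by (auto simp: cutoff_def indicator_def)
    then have h1: "integrable lborel ?h"
      using integrable_cutoff[OF h2, of m] by simp
    have Jh: "integrable lborel (\<lambda>t. ?J t * cnj (?h t))"
    proof -
      have "integrable lborel (\<lambda>t. cutoff m ?J t * cnj (?h t))"
        by (rule square_integrable_mult_integrable[OF J square_integrable_cnj[OF h2]])
      moreover have "cutoff m ?J t * cnj (?h t) = ?J t * cnj (?h t)" for t
        by (simp add: cutoff_def indicator_def)
      ultimately show ?thesis by simp
    qed
    let ?y = "LINT t|lborel. (norm (?h t))\<^sup>2"
    have "complex_of_real ?y = (LINT t|lborel. of_real C * (f t * cnj (?h t)) - ?J t * cnj (?h t))"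
      unfolding integral_complex_of_real[symmetric] complex_norm_square
      by (intro Bochner_Integration.integral_cong) (auto simp: cutoff_def indicator_def algebra_simps)
    also have "\<dots> = of_real C * (LINT t|lborel. f t * cnj (?h t)) - (LINT t|lborel. ?J t * cnj (?h t))"
      using square_integrable_mult_integrable[OF f square_integrable_cnj[OF h2]] Jh by simp
    also have "\<dots> = (LINT x|N. coef f x * cnj (coef ?h x)) - (LINT x|N. (indicator E x *\<^sub>R coef f x) * cnj (coef ?h x))"
      unfolding partial_synthesis_inner[OF h1 h2] coef_inner[OF f h1 h2] ..
    also have "\<dots> = (LINT x|N. coef f x * cnj (coef ?h x) - (indicator E x *\<^sub>R coef f x) * cnj (coef ?h x))"
      by (rule Bochner_Integration.integral_diff[symmetric];
          intro square_integrable_mult_integrable square_integrable_cnj square_integrable_coef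
            square_integrable_restricted_coef f h2)
    also have "\<dots> = (LINT x|N. (indicator (- E) x *\<^sub>R coef f x) * cnj (coef ?h x))"
      by (intro Bochner_Integration.integral_cong) (auto simp: indicator_def)
    finally have eq: "complex_of_real ?y = (LINT x|N. (indicator (- E) x *\<^sub>R coef f x) * cnj (coef ?h x))" .
    have "?y\<^sup>2 = (norm (complex_of_real ?y))\<^sup>2"
      by (simp only: norm_of_real power2_abs)
    also have "\<dots> \<le> ?T * (LINT x|N. (norm (cnj (coef ?h x)))\<^sup>2)"
      unfolding eq
      by (rule square_integrable_Cauchy_Schwarz_inner[OF rest square_integrable_cnj[OF square_integrable_coef[OF h2]]])
    also have "\<dots> \<le> ?T * (C * ?y)"
      using coef_norm_square_le[OF h2] by (intro mult_left_mono) (auto simp: integral_nonneg_AE)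
    finally have "?y * ?y \<le> (C * ?T) * ?y"
      by (simp add: power2_eq_square ac_simps)
    moreover have "0 \<le> ?y" "0 \<le> C * ?T"
      using bound_nonneg by (auto simp: integral_nonneg_AE)
    ultimately have "?y \<le> C * ?T"
      by (cases "?y = 0") (auto simp: mult_le_cancel_right)
    then show ?thesis
      unfolding nn_integral_square[OF h2] by (rule ennreal_leI)
  qed
  show ?thesis
  proof (rule nn_integral_le_of_tendsto[OF _ _ cut])
    show "(\<lambda>t. ennreal ((norm (cutoff m ?d t))\<^sup>2)) \<in> borel_measurable lborel" for m by measurable
    show "(\<lambda>m. ennreal ((norm (cutoff m ?d t))\<^sup>2)) \<longlonglongrightarrow> ennreal ((norm (?d t))\<^sup>2)" for t
      by (intro tendsto_ennrealI tendsto_power tendsto_norm cutoff_tendsto)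
  qed
qed

end

end

section \<open>The half plane with the measure \<open>db da / a\<^sup>2\<close>\<close>

definition half_plane_weight :: "real \<times> real \<Rightarrow> real" where
  "half_plane_weight x = indicator half_plane x / (snd x)\<^sup>2"

definition half_plane_measure :: "(real \<times> real) measure" where
  "half_plane_measure = density lborel (\<lambda>x. ennreal (half_plane_weight x))"

lemma borel_measurable_fst_snd:
  "(fst :: real \<times> real \<Rightarrow> real) \<in> borel_measurable borel"
  "(snd :: real \<times> real \<Rightarrow> real) \<in> borel_measurable borel"
  by (auto intro!: borel_measurable_continuous_onI continuous_intros)

lemma half_plane_iff: "x \<in> half_plane \<longleftrightarrow> 0 < snd x"
  by (cases x) (simp add: half_plane_def)

lemma half_plane_borel [measurable]: "half_plane \<in> sets borel"
  unfolding half_plane_def by (intro borel_open open_Times) auto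

lemma half_plane_weight_nonneg: "0 \<le> half_plane_weight x"
  by (simp add: half_plane_weight_def indicator_def)

lemma half_plane_weight_measurable [measurable]: "half_plane_weight \<in> borel_measurable borel"
  using borel_measurable_fst_snd unfolding half_plane_weight_def[abs_def] by measurable

lemma sets_half_plane_measure [measurable_cong, simp]: "sets half_plane_measure = sets borel"
  by (simp add: half_plane_measure_def)

lemma space_half_plane_measure [simp]: "space half_plane_measure = UNIV"
  by (simp add: half_plane_measure_def)

lemma sigma_finite_half_plane_measure: "sigma_finite_measure half_plane_measure"
  unfolding half_plane_measure_def
  by (subst sigma_finite_measure.sigma_finite_iff_density_finite[OF lborel.sigma_finite_measure_axioms]) auto

lemma nn_integral_half_plane_measure:
  assumes [measurable]: "F \<in> borel_measurable borel"
  shows "(\<integral>\<^sup>+x. F x \<partial>half_plane_measure)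
      = (\<integral>\<^sup>+a\<in>{0<..}. ennreal (1 / a\<^sup>2) * (\<integral>\<^sup>+b. F (b, a) \<partial>lborel) \<partial>lborel)"
proof -
  have Fm: "(\<lambda>x. ennreal (half_plane_weight x) * F x) \<in> borel_measurable (lborel \<Otimes>\<^sub>M lborel)"
    unfolding lborel_prod by measurable
  have F_section: "(\<lambda>b. F (b, a)) \<in> borel_measurable lborel" for a
    by measurable
  have "(\<integral>\<^sup>+x. F x \<partial>half_plane_measure) = (\<integral>\<^sup>+x. ennreal (half_plane_weight x) * F x \<partial>lborel)"
    unfolding half_plane_measure_def by (rule nn_integral_density) auto
  also have "\<dots> = (\<integral>\<^sup>+a. \<integral>\<^sup>+b. ennreal (half_plane_weight (b, a)) * F (b, a) \<partial>lborel \<partial>lborel)"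
    unfolding lborel_prod[symmetric] by (rule lborel_pair.nn_integral_snd[OF Fm, symmetric])
  also have "\<dots> = (\<integral>\<^sup>+a\<in>{0<..}. ennreal (1 / a\<^sup>2) * (\<integral>\<^sup>+b. F (b, a) \<partial>lborel) \<partial>lborel)"
  proof (rule nn_integral_cong)
    fix a :: real
    have "half_plane_weight (b, a) = indicator {0<..} a / a\<^sup>2" for b
      by (simp add: half_plane_weight_def half_plane_iff indicator_def)
    then show "(\<integral>\<^sup>+b. ennreal (half_plane_weight (b, a)) * F (b, a) \<partial>lborel)
        = ennreal (1 / a\<^sup>2) * (\<integral>\<^sup>+b. F (b, a) \<partial>lborel) * indicator {0<..} a"
      using nn_integral_cmult[OF F_section, of "ennreal (1 / a\<^sup>2)" a] by (simp add: indicator_def)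
  qed
  finally show ?thesis .
qed

lemma half_plane_measure_AE: "AE x in half_plane_measure. x \<in> half_plane"
proof -
  have "AE x in lborel. 0 < ennreal (half_plane_weight x) \<longrightarrow> x \<in> half_plane"
    by (auto simp: half_plane_weight_def indicator_def)
  then show ?thesis
    unfolding half_plane_measure_def by (subst AE_density) simp_all
qed

lemma
  fixes F :: "real \<times> real \<Rightarrow> complex"
  assumes [measurable]: "F \<in> borel_measurable borel" "E \<in> sets borel" and E: "E \<subseteq> half_plane"
  shows set_integrable_half_plane_measure:
      "set_integrable half_plane_measure E F \<longleftrightarrow> set_integrable lborel E (\<lambda>x. F x / of_real ((snd x)\<^sup>2))"
    and set_integral_half_plane_measure:
      "(LINT x:E|half_plane_measure. F x) = (LINT x:E|lborel. F x / of_real ((snd x)\<^sup>2))"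
proof -
  have eq: "half_plane_weight x *\<^sub>R (indicator E x *\<^sub>R F x) = indicator E x *\<^sub>R (F x / of_real ((snd x)\<^sup>2))" for x
    using E by (auto simp: half_plane_weight_def indicator_def scaleR_conv_of_real)
  have meas: "(\<lambda>x. indicator E x *\<^sub>R F x) \<in> borel_measurable lborel"
    by measurable
  show "set_integrable half_plane_measure E F \<longleftrightarrow> set_integrable lborel E (\<lambda>x. F x / of_real ((snd x)\<^sup>2))"
    unfolding set_integrable_def half_plane_measure_def eq[symmetric]
    by (rule integrable_density[OF meas]) (auto simp: half_plane_weight_nonneg)
  show "(LINT x:E|half_plane_measure. F x) = (LINT x:E|lborel. F x / of_real ((snd x)\<^sup>2))"
    unfolding set_lebesgue_integral_def half_plane_measure_def eq[symmetric]
    by (rule integral_density[OF meas]) (auto simp: half_plane_weight_nonneg)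
qed

section \<open>The wavelets of the special affine transform\<close>

lemma borel_measurable_csqrt [measurable]: "csqrt \<in> borel_measurable borel"
  unfolding borel_measurable_complex_iff csqrt.simps by measurable

lemma exp_chirp: "exp (\<i> / of_real (2 * B) * of_real y) = cis (y / (2 * B))"
  by (simp add: cis_conv_exp)

lemma exp_chirp_minus: "exp (- (\<i> / of_real (2 * B)) * of_real y) = cis (- (y / (2 * B)))"
  by (simp add: cis_conv_exp)

text \<open>The indices \<open>(b, a)\<close> are paired, so that the wavelets form a family over the half plane.\<close>

definition SA_frame :: "saft_params \<Rightarrow> (real \<Rightarrow> complex) \<Rightarrow> real \<times> real \<Rightarrow> real \<Rightarrow> complex" where
  "SA_frame M \<psi> x t = SA_wavelet M \<psi> (fst x) (snd x) t"

lemma SA_frame_measurable: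
  assumes [measurable]: "\<psi> \<in> borel_measurable borel"
  shows "case_prod (SA_frame (A, B, C, D, p, q) \<psi>) \<in> borel_measurable (half_plane_measure \<Otimes>\<^sub>M lborel)"
proof -
  have fst: "fst \<in> half_plane_measure \<Otimes>\<^sub>M lborel \<rightarrow>\<^sub>M borel"
    by measurable
  have [measurable]: "(\<lambda>x. fst (fst x)) \<in> borel_measurable (half_plane_measure \<Otimes>\<^sub>M lborel)"
    "(\<lambda>x. snd (fst x)) \<in> borel_measurable (half_plane_measure \<Otimes>\<^sub>M lborel)"
    using measurable_compose[OF fst borel_measurable_fst_snd(1)]
      measurable_compose[OF fst borel_measurable_fst_snd(2)] by auto
  show ?thesis
    unfolding SA_frame_def[abs_def] SA_wavelet.simps case_prod_unfold exp_chirp_minus by measurable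
qed

lemma SA_wavelet_norm:
  assumes "a > 0"
  shows "(norm (SA_wavelet (A, B, C, D, p, q) \<psi> b a t))\<^sup>2
      = 1 / (2 * pi * a * \<bar>B\<bar>) * (norm (\<psi> ((t - b) / a)))\<^sup>2"
proof -
  have "norm (csqrt (\<i> * of_real (2 * pi * a * B))) = sqrt (2 * pi * a * \<bar>B\<bar>)"
    using assms by (simp only: norm_csqrt norm_mult norm_ii norm_of_real) (simp add: abs_mult)
  then show ?thesis
    using assms unfolding SA_wavelet.simps exp_chirp_minus
    by (simp add: norm_mult norm_divide power_mult_distrib power_divide)
qed

lemma SA_frame_square_integrable:
  assumes \<psi>: "square_integrable lborel \<psi>"
  shows "square_integrable lborel (SA_frame (A, B, C, D, p, q) \<psi> x)"
proof (cases "snd x = 0")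
  case True
  then have "SA_frame (A, B, C, D, p, q) \<psi> x = (\<lambda>t. 0)"
    by (simp add: SA_frame_def fun_eq_iff)
  then show ?thesis by (simp add: square_integrable_def)
next
  case False
  note [measurable] = square_integrable_measurable[OF \<psi>]
  have "square_integrable lborel (\<lambda>t. \<psi> ((t - fst x) / snd x))"
    using square_integrable_affine[OF \<psi>, of "1 / snd x" "- fst x / snd x"] False
    by (simp add: diff_divide_distrib)
  then show ?thesis
  proof (rule square_integrable_bound)
    show "SA_frame (A, B, C, D, p, q) \<psi> x \<in> borel_measurable lborel"
      unfolding SA_frame_def[abs_def] SA_wavelet.simps exp_chirp_minus by measurable
    show "norm (SA_frame (A, B, C, D, p, q) \<psi> x t)
        \<le> norm (1 / csqrt (\<i> * of_real (2 * pi * snd x * B))) * norm (\<psi> ((t - fst x) / snd x))" for t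
      unfolding SA_frame_def SA_wavelet.simps exp_chirp_minus by (simp only: norm_mult norm_cis)
  qed
qed

text \<open>One part of the chirp depends on \<open>t\<close> alone and is absorbed into \<open>f\<close>; the rest depends on
  \<open>b\<close> and \<open>a\<close> alone and disappears from the modulus.\<close>

lemma SAWT_norm:
  assumes a: "a > 0"
  shows "(norm (LINT t|lborel. f t * cnj (SA_wavelet (A, B, C, D, p, q) \<psi> b a t)))\<^sup>2
      = 1 / (2 * pi * a * \<bar>B\<bar>) *
        (norm (LINT t|lborel. f t * cis (A * t\<^sup>2 / (2 * B)) * cnj (\<psi> ((t - b) / a))))\<^sup>2"
proof -
  let ?\<kappa> = "1 / csqrt (\<i> * of_real (2 * pi * a * B))"
  let ?w = "cis ((D * p\<^sup>2 - A * (b / a)\<^sup>2) / (2 * B))"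
  have "f t * cnj (SA_wavelet (A, B, C, D, p, q) \<psi> b a t)
      = (cnj ?\<kappa> * ?w) * (f t * cis (A * t\<^sup>2 / (2 * B)) * cnj (\<psi> ((t - b) / a)))" for t
  proof -
    have "cis ((A * t\<^sup>2 + D * p\<^sup>2 - A * (b / a)\<^sup>2) / (2 * B)) = ?w * cis (A * t\<^sup>2 / (2 * B))"
      by (simp add: cis_mult add_divide_distrib diff_divide_distrib ac_simps add_diff_eq)
    then show ?thesis
      unfolding SA_wavelet.simps exp_chirp_minus complex_cnj_mult cis_cnj minus_minus
      by (simp only: ac_simps)
  qed
  then have "(LINT t|lborel. f t * cnj (SA_wavelet (A, B, C, D, p, q) \<psi> b a t))
      = (cnj ?\<kappa> * ?w) * (LINT t|lborel. f t * cis (A * t\<^sup>2 / (2 * B)) * cnj (\<psi> ((t - b) / a)))"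
    by (simp only: integral_mult_right_zero)
  moreover have "(norm (cnj ?\<kappa> * ?w))\<^sup>2 = 1 / (2 * pi * a * \<bar>B\<bar>)"
    using SA_wavelet_norm[OF a, of A B C D p q "\<lambda>_. 1" b 0]
    unfolding SA_wavelet.simps exp_chirp_minus by (simp only: norm_mult norm_cis complex_mod_cnj norm_one power_one mult_1_right)
  ultimately show ?thesis
    by (simp only: norm_mult power_mult_distrib)
qed

section \<open>The admissibility condition\<close>

text \<open>The chirp \<open>exp (-i A z\<^sup>2 / (2 B))\<close> of the admissibility function cancels that of the kernel,
  and its factor linear in \<open>z\<close> replaces \<open>z (p - \<omega>)\<close> by \<open>z (p a - \<omega>)\<close>. At \<open>\<omega> = p a + B \<xi>\<close> there
  remains \<open>- B \<xi> z\<close>, and the reflection and conjugation of \<open>\<psi>\<close> turn the integral into the conjugate of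
  the Fourier transform of \<open>\<psi>\<close>.\<close>

lemma SAFT_adm_function_truncated:
  assumes B: "B \<noteq> 0"
  shows "(LINT z:{- real n..real n}|lborel.
        adm_function (A, B, C, D, p, q) \<psi> a z * SAFT_kernel (A, B, C, D, p, q) z (p * a + B * \<xi>))
      = 1 / csqrt (\<i> * of_real (2 * pi * B)) *
        cis ((D * ((p * a + B * \<xi>)\<^sup>2 + p\<^sup>2) - 2 * (p * a + B * \<xi>) * (D * p - B * q)) / (2 * B)) *
        cnj (fourier (cutoff n \<psi>) \<xi>)"
proof -
  let ?\<omega> = "p * a + B * \<xi>"
  let ?\<kappa> = "1 / csqrt (\<i> * of_real (2 * pi * B))"
  let ?\<theta> = "(D * (?\<omega>\<^sup>2 + p\<^sup>2) - 2 * ?\<omega> * (D * p - B * q)) / (2 * B)"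
  have eq: "indicator {- real n..real n} z *\<^sub>R
        (adm_function (A, B, C, D, p, q) \<psi> a z * SAFT_kernel (A, B, C, D, p, q) z ?\<omega>)
      = ?\<kappa> * cis ?\<theta> * cnj (cutoff n \<psi> (0 + (-1) * z) * cis (- (\<xi> * (0 + (-1) * z))))" for z
  proof -
    have "cis ((2 * z * p * (a - 1) - A * z\<^sup>2) / (2 * B)) *
        cis ((A * z\<^sup>2 + 2 * z * (p - ?\<omega>) - 2 * ?\<omega> * (D * p - B * q) + D * (?\<omega>\<^sup>2 + p\<^sup>2)) / (2 * B))
        = cis ?\<theta> * cis (- (\<xi> * z))"
    proof -
      have "(2 * z * p * (a - 1) - A * z\<^sup>2) / (2 * B) +
          (A * z\<^sup>2 + 2 * z * (p - ?\<omega>) - 2 * ?\<omega> * (D * p - B * q) + D * (?\<omega>\<^sup>2 + p\<^sup>2)) / (2 * B)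
          = ?\<theta> + - (\<xi> * z)"
        using B by (simp add: field_simps)
      then show ?thesis by (simp only: cis_mult)
    qed
    moreover have "indicator {- real n..real n} (- z) = indicat_real {- real n..real n} z"
      by (auto simp: indicator_def)
    ultimately show ?thesis
      unfolding adm_function.simps SAFT_kernel.simps exp_chirp cutoff_def
      by (simp add: scaleR_conv_of_real cis_cnj ac_simps)
  qed
  have "(LINT z:{- real n..real n}|lborel.
        adm_function (A, B, C, D, p, q) \<psi> a z * SAFT_kernel (A, B, C, D, p, q) z ?\<omega>)
      = (LINT z|lborel. ?\<kappa> * cis ?\<theta> * cnj (cutoff n \<psi> (0 + (-1) * z) * cis (- (\<xi> * (0 + (-1) * z)))))"
    unfolding set_lebesgue_integral_def eq ..
  also have "\<dots> = ?\<kappa> * cis ?\<theta> * cnj (LINT z|lborel. cutoff n \<psi> (0 + (-1) * z) * cis (- (\<xi> * (0 + (-1) * z))))"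
    unfolding integral_mult_right_zero Bochner_Integration.integral_cnj ..
  also have "(LINT z|lborel. cutoff n \<psi> (0 + (-1) * z) * cis (- (\<xi> * (0 + (-1) * z)))) = fourier (cutoff n \<psi>) \<xi>"
    unfolding fourier_def
    by (subst (2) lborel_integral_real_affine[of "-1" _ 0]) simp_all
  finally show ?thesis .
qed

text \<open>By \<open>SAFT_adm_function_truncated\<close> the Fourier integrals of the cutoffs of \<open>\<psi>\<close>
  inherit \<open>L\<^sup>2\<close> convergence from those of the SAFT.
  The Plancherel transform \<open>\<Psi>\<close> of \<open>\<psi>\<close> is recovered from \<open>S\<close> by dividing out the constant and the
  unimodular factor.\<close>

lemma weak_fourier_of_SAFT:
  assumes B: "B \<noteq> 0" and \<psi>: "square_integrable lborel \<psi>"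
    and S: "is_SAFT (A, B, C, D, p, q) (adm_function (A, B, C, D, p, q) \<psi> a) S"
  obtains \<Psi> where "weak_fourier \<psi> \<Psi>"
    and "\<And>\<xi>. (norm (\<Psi> \<xi>))\<^sup>2 = 2 * pi * \<bar>B\<bar> * (norm (S (p * a + B * \<xi>)))\<^sup>2"
proof -
  let ?\<kappa> = "1 / csqrt (\<i> * of_real (2 * pi * B))"
  let ?\<theta> = "\<lambda>\<xi>. (D * ((p * a + B * \<xi>)\<^sup>2 + p\<^sup>2) - 2 * (p * a + B * \<xi>) * (D * p - B * q)) / (2 * B)"
  define T where "T n \<omega> = (LINT z:{- real n..real n}|lborel.
      adm_function (A, B, C, D, p, q) \<psi> a z * SAFT_kernel (A, B, C, D, p, q) z \<omega>)" for n \<omega>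
  define \<Psi> where "\<Psi> \<xi> = cnj (S (p * a + B * \<xi>) / (?\<kappa> * cis (?\<theta> \<xi>)))" for \<xi>
  have S2: "square_integrable lborel S"
    and lim: "(\<lambda>n. \<integral>\<^sup>+\<omega>. ennreal ((norm (T n \<omega> - S \<omega>))\<^sup>2) \<partial>lborel) \<longlonglongrightarrow> 0"
    and T_meas: "\<And>n. T n \<in> borel_measurable lborel"
    using S by (auto simp: is_SAFT_def tendsto_L2_def T_def[abs_def] L2_iff_square_integrable)
  note [measurable] = square_integrable_measurable[OF S2] T_meas
  have \<kappa>: "(norm ?\<kappa>)\<^sup>2 = 1 / (2 * pi * \<bar>B\<bar>)"
    by (simp add: norm_divide norm_mult power_divide abs_mult)
  have \<kappa>0: "?\<kappa> \<noteq> 0" using B by simp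
  have norm_\<Psi>: "(norm (\<Psi> \<xi>))\<^sup>2 = 2 * pi * \<bar>B\<bar> * (norm (S (p * a + B * \<xi>)))\<^sup>2" for \<xi>
    unfolding \<Psi>_def complex_mod_cnj norm_divide norm_mult norm_cis mult_1_right power_divide \<kappa>[unfolded norm_divide]
    using \<kappa> by (simp add: norm_divide power_divide)
  have \<Psi>2: "square_integrable lborel \<Psi>"
  proof -
    have "square_integrable lborel (\<lambda>\<xi>. S (p * a + B * \<xi>))"
      using square_integrable_affine[OF S2 B] by simp
    moreover have "\<Psi> \<in> borel_measurable lborel"
      unfolding \<Psi>_def[abs_def] by measurable
    moreover have "norm (\<Psi> \<xi>) \<le> 1 / norm ?\<kappa> * norm (S (p * a + B * \<xi>))" for \<xi>
      unfolding \<Psi>_def complex_mod_cnj norm_divide norm_mult norm_cis by simp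
    ultimately show ?thesis
      by (rule square_integrable_bound)
  qed
  have F2: "square_integrable lborel (\<lambda>\<xi>. fourier (cutoff n \<psi>) \<xi> - \<Psi> \<xi>)" for n
    by (rule square_integrable_diff[OF Plancherel(1)[OF integrable_cutoff[OF \<psi>] square_integrable_cutoff[OF \<psi>]] \<Psi>2])
  have diff: "(norm (fourier (cutoff n \<psi>) \<xi> - \<Psi> \<xi>))\<^sup>2
      = 2 * pi * \<bar>B\<bar> * (norm (T n (p * a + B * \<xi>) - S (p * a + B * \<xi>)))\<^sup>2" for n \<xi>
  proof -
    have T: "T n (p * a + B * \<xi>) = ?\<kappa> * cis (?\<theta> \<xi>) * cnj (fourier (cutoff n \<psi>) \<xi>)"
      unfolding T_def by (rule SAFT_adm_function_truncated[OF B])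
    have "S (p * a + B * \<xi>) = ?\<kappa> * cis (?\<theta> \<xi>) * cnj (\<Psi> \<xi>)"
      using \<kappa>0 by (simp only: \<Psi>_def complex_cnj_cnj) simp
    with T have "T n (p * a + B * \<xi>) - S (p * a + B * \<xi>)
        = ?\<kappa> * cis (?\<theta> \<xi>) * cnj (fourier (cutoff n \<psi>) \<xi> - \<Psi> \<xi>)"
      by (simp only: complex_cnj_diff right_diff_distrib)
    then have "(norm (T n (p * a + B * \<xi>) - S (p * a + B * \<xi>)))\<^sup>2
        = (norm ?\<kappa>)\<^sup>2 * (norm (fourier (cutoff n \<psi>) \<xi> - \<Psi> \<xi>))\<^sup>2"
      by (simp only: norm_mult norm_cis complex_mod_cnj mult_1_right power_mult_distrib)
    then show ?thesis
      unfolding \<kappa> using B by simp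
  qed
  have "ennreal (LINT \<xi>|lborel. (norm (fourier (cutoff n \<psi>) \<xi> - \<Psi> \<xi>))\<^sup>2)
      = ennreal (2 * pi) * (\<integral>\<^sup>+\<omega>. ennreal ((norm (T n \<omega> - S \<omega>))\<^sup>2) \<partial>lborel)" for n
  proof -
    have m: "(\<lambda>\<xi>. ennreal ((norm (T n (p * a + B * \<xi>) - S (p * a + B * \<xi>)))\<^sup>2)) \<in> borel_measurable lborel"
      by measurable
    have "ennreal (LINT \<xi>|lborel. (norm (fourier (cutoff n \<psi>) \<xi> - \<Psi> \<xi>))\<^sup>2)
        = (\<integral>\<^sup>+\<xi>. ennreal (2 * pi * \<bar>B\<bar>) * ennreal ((norm (T n (p * a + B * \<xi>) - S (p * a + B * \<xi>)))\<^sup>2) \<partial>lborel)"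
      unfolding nn_integral_square[OF F2, symmetric] unfolding diff
      by (intro nn_integral_cong ennreal_mult) auto
    also have "\<dots> = ennreal (2 * pi * \<bar>B\<bar>) *
        (\<integral>\<^sup>+\<xi>. ennreal ((norm (T n (p * a + B * \<xi>) - S (p * a + B * \<xi>)))\<^sup>2) \<partial>lborel)"
      by (rule nn_integral_cmult[OF m])
    also have "\<dots> = ennreal (2 * pi) * (\<integral>\<^sup>+\<omega>. ennreal ((norm (T n \<omega> - S \<omega>))\<^sup>2) \<partial>lborel)"
      using nn_integral_real_affine[of "\<lambda>\<omega>. ennreal ((norm (T n \<omega> - S \<omega>))\<^sup>2)" B "p * a"] B
      by (simp add: ennreal_mult mult.assoc)
    finally show ?thesis .
  qed
  moreover have "(\<lambda>n. ennreal (2 * pi) * (\<integral>\<^sup>+\<omega>. ennreal ((norm (T n \<omega> - S \<omega>))\<^sup>2) \<partial>lborel)) \<longlonglongrightarrow> ennreal (2 * pi) * 0"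
    using lim by (intro ennreal_tendsto_cmult) auto
  ultimately have "(\<lambda>n. ennreal (LINT \<xi>|lborel. (norm (fourier (cutoff n \<psi>) \<xi> - \<Psi> \<xi>))\<^sup>2)) \<longlonglongrightarrow> ennreal 0"
    by simp
  then have "(\<lambda>n. LINT \<xi>|lborel. (norm (fourier (cutoff n \<psi>) \<xi> - \<Psi> \<xi>))\<^sup>2) \<longlonglongrightarrow> 0"
    by (rule tendsto_ennreal_iff[THEN iffD1, rotated 2]) (auto simp: integral_nonneg_AE)
  from weak_fourier_of_limit[OF \<psi> \<Psi>2 this] norm_\<Psi> show thesis
    by (rule that)
qed

text \<open>By \<open>correlation_Plancherel\<close> the energy of the coefficients at scale \<open>a\<close> is an integral of
  \<open>|fourier g \<xi>|\<^sup>2 |\<Psi> (a \<xi>)|\<^sup>2\<close> over \<open>\<xi>\<close>, where \<open>|\<Psi> (a \<xi>)|\<^sup>2\<close> is a multiple of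
  \<open>|S a (a (p + B \<xi>))|\<^sup>2\<close>. Integrating over \<open>a\<close> first produces the admissibility integral at
  \<open>\<omega> = p + B \<xi>\<close>, which is \<open>c\<close> for almost every \<open>\<xi>\<close>; Plancherel's theorem for \<open>g\<close> then leaves
  \<open>c \<parallel>f\<parallel>\<^sup>2\<close>.\<close>

lemma SAWT_isometry:
  assumes B: "B \<noteq> 0" and \<psi>: "square_integrable lborel \<psi>"
    and adm: "admissibility_constant (A, B, C, D, p, q) \<psi> c"
    and f: "integrable lborel f" "square_integrable lborel f"
  shows "(\<integral>\<^sup>+x. ennreal ((norm (LINT t|lborel. f t * cnj (SA_frame (A, B, C, D, p, q) \<psi> x t)))\<^sup>2)
      \<partial>half_plane_measure) = ennreal c * (\<integral>\<^sup>+t. ennreal ((norm (f t))\<^sup>2) \<partial>lborel)"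
proof -
  let ?M = "(A, B, C, D, p, q)"
  obtain S where S_meas: "case_prod S \<in> borel_measurable (lborel \<Otimes>\<^sub>M lborel)"
    and S: "\<And>a. a > 0 \<Longrightarrow> is_SAFT ?M (adm_function ?M \<psi> a) (S a)"
    and S_c: "AE \<omega> in lborel. (\<integral>\<^sup>+a\<in>{0<..}. ennreal (1 / a * (norm (S a (a * \<omega>)))\<^sup>2) \<partial>lborel) = ennreal c"
    and c: "0 \<le> c"
    using adm unfolding admissibility_constant_def by blast
  have S_pair: "(\<lambda>x. S (fst x) (snd x)) \<in> borel_measurable (borel \<Otimes>\<^sub>M borel)"
    using S_meas by (simp add: case_prod_unfold cong: measurable_cong_sets sets_pair_measure_cong)
  have S_comp: "(\<lambda>x. S (u x) (v x)) \<in> borel_measurable N"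
    if "u \<in> borel_measurable N" "v \<in> borel_measurable N" for u v and N :: "'n measure"
    using measurable_compose[OF measurable_Pair[OF that] S_pair] by simp
  note [measurable (raw)] = S_comp

  define g where "g t = f t * cis (A * t\<^sup>2 / (2 * B))" for t
  note [measurable] = square_integrable_measurable[OF f(2)]
  have g: "integrable lborel g" "square_integrable lborel g"
  proof -
    show "integrable lborel g"
      unfolding g_def[abs_def] by (rule integrable_mult_unimodular[OF f(1)]) auto
    show "square_integrable lborel g"
      unfolding g_def[abs_def] by (rule square_integrable_bound[OF f(2), of _ 1]) (auto simp: norm_mult)
  qed
  have norm_g: "norm (g t) = norm (f t)" for t
    by (simp add: g_def norm_mult)
  note [measurable] = square_integrable_measurable[OF g(2)]

  \<comment> \<open>Up to the factor \<open>2\<pi>\<close>, the contribution of the scale \<open>a\<close> to the total energy.\<close>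
  define Q where "Q a = (\<integral>\<^sup>+\<xi>. ennreal ((norm (fourier g \<xi>))\<^sup>2) *
      (ennreal (1 / a * (norm (S a (a * (p + B * \<xi>))))\<^sup>2) * indicator {0<..} a) \<partial>lborel)" for a
  have Q_integrand [measurable]: "(\<lambda>x. ennreal ((norm (fourier g (snd x)))\<^sup>2) *
      (ennreal (1 / fst x * (norm (S (fst x) (fst x * (p + B * snd x))))\<^sup>2) * indicator {0<..} (fst x)))
      \<in> borel_measurable (borel \<Otimes>\<^sub>M borel)"
    by measurable
  have Q_meas: "Q \<in> borel_measurable borel"
    unfolding Q_def[abs_def] by measurable

  have "(\<integral>\<^sup>+a. Q a \<partial>lborel) = (\<integral>\<^sup>+\<xi>. \<integral>\<^sup>+a. ennreal ((norm (fourier g \<xi>))\<^sup>2) *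
      (ennreal (1 / a * (norm (S a (a * (p + B * \<xi>))))\<^sup>2) * indicator {0<..} a) \<partial>lborel \<partial>lborel)"
    unfolding Q_def by (rule lborel_pair.Fubini'[symmetric]) (simp add: case_prod_unfold)
  also have "\<dots> = (\<integral>\<^sup>+\<xi>. ennreal ((norm (fourier g \<xi>))\<^sup>2) * ennreal c \<partial>lborel)"
  proof (rule nn_integral_cong_AE)
    have "AE \<xi> in lborel. (\<integral>\<^sup>+a\<in>{0<..}. ennreal (1 / a * (norm (S a (a * (p + B * \<xi>))))\<^sup>2) \<partial>lborel) = ennreal c"
    proof (rule AE_borel_affine[OF B _ S_c])
      have "(\<lambda>\<omega>. \<integral>\<^sup>+a\<in>{0<..}. ennreal (1 / a * (norm (S a (a * \<omega>)))\<^sup>2) \<partial>lborel) \<in> borel_measurable borel"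
        by measurable
      from measurable_sets[OF this, of "{ennreal c}"]
      show "Measurable.pred borel
          (\<lambda>\<omega>. (\<integral>\<^sup>+a\<in>{0<..}. ennreal (1 / a * (norm (S a (a * \<omega>)))\<^sup>2) \<partial>lborel) = ennreal c)"
        by (simp add: pred_def vimage_def)
    qed
    then show "AE \<xi> in lborel. (\<integral>\<^sup>+a. ennreal ((norm (fourier g \<xi>))\<^sup>2) *
        (ennreal (1 / a * (norm (S a (a * (p + B * \<xi>))))\<^sup>2) * indicator {0<..} a) \<partial>lborel)
        = ennreal ((norm (fourier g \<xi>))\<^sup>2) * ennreal c"
    proof eventually_elim
      case (elim \<xi>)
      have "(\<lambda>a. ennreal (1 / a * (norm (S a (a * (p + B * \<xi>))))\<^sup>2) * indicator {0<..} a) \<in> borel_measurable lborel"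
        by measurable
      from nn_integral_cmult[OF this] elim show ?case by simp
    qed
  qed
  also have "\<dots> = ennreal c * (\<integral>\<^sup>+\<xi>. ennreal ((norm (fourier g \<xi>))\<^sup>2) \<partial>lborel)"
    by (subst nn_integral_multc) (auto simp: mult.commute)
  also have "\<dots> = ennreal (2 * pi) * (ennreal c * (\<integral>\<^sup>+t. ennreal ((norm (f t))\<^sup>2) \<partial>lborel))"
    unfolding nn_integral_square[OF Plancherel(1)[OF g]] Plancherel(2)[OF g] nn_integral_square[OF f(2)] norm_g
    by (subst ennreal_mult) (auto simp: integral_nonneg_AE ac_simps)
  finally have Q_total: "(\<integral>\<^sup>+a. Q a \<partial>lborel)
      = ennreal (2 * pi) * (ennreal c * (\<integral>\<^sup>+t. ennreal ((norm (f t))\<^sup>2) \<partial>lborel))" .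
  also have "\<dots> \<noteq> \<infinity>"
    unfolding nn_integral_square[OF f(2)] by (simp add: ennreal_mult_eq_top_iff)
  finally have Q_finite: "AE a in lborel. Q a \<noteq> \<infinity>"
    using Q_meas by (intro nn_integral_noteq_infinite) auto

  \<comment> \<open>Finiteness of \<open>Q a\<close> is what puts the product of the transforms into \<open>L\<^sup>2\<close>.\<close>
  have slice: "ennreal (1 / a\<^sup>2) * (\<integral>\<^sup>+b. ennreal ((norm (LINT t|lborel. f t * cnj (SA_frame ?M \<psi> (b, a) t)))\<^sup>2) \<partial>lborel)
      = ennreal (1 / (2 * pi)) * Q a" if a: "a > 0" and fin: "Q a \<noteq> \<infinity>" for a
  proof -
    obtain \<Psi> where \<Psi>: "weak_fourier \<psi> \<Psi>"
      and norm_\<Psi>: "\<And>\<xi>. (norm (\<Psi> \<xi>))\<^sup>2 = 2 * pi * \<bar>B\<bar> * (norm (S a (p * a + B * \<xi>)))\<^sup>2"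
      using weak_fourier_of_SAFT[OF B \<psi> S[OF a]] by blast
    let ?corr = "\<lambda>b. LINT t|lborel. g t * cnj (\<psi> ((t - b) / a))"
    let ?I = "\<integral>\<^sup>+\<xi>. ennreal ((norm (fourier g \<xi> * cnj (\<Psi> (a * \<xi>))))\<^sup>2) \<partial>lborel"
    have I: "?I = ennreal (2 * pi * \<bar>B\<bar> * a) * Q a"
    proof -
      have m: "(\<lambda>\<xi>. ennreal ((norm (fourier g \<xi>))\<^sup>2) *
          (ennreal (1 / a * (norm (S a (a * (p + B * \<xi>))))\<^sup>2) * indicator {0<..} a)) \<in> borel_measurable lborel"
        by measurable
      have "?I = (\<integral>\<^sup>+\<xi>. ennreal (2 * pi * \<bar>B\<bar> * a) * (ennreal ((norm (fourier g \<xi>))\<^sup>2) *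
          (ennreal (1 / a * (norm (S a (a * (p + B * \<xi>))))\<^sup>2) * indicator {0<..} a)) \<partial>lborel)"
      proof (rule nn_integral_cong)
        fix \<xi>
        have arg: "p * a + B * (a * \<xi>) = a * (p + B * \<xi>)"
          by (simp add: algebra_simps)
        have ennreal_mult3: "ennreal (k * (x * y)) = ennreal k * (ennreal x * ennreal y)"
          if "0 \<le> k" "0 \<le> x" "0 \<le> y" for k x y :: real
          using that by (simp add: ennreal_mult)
        have eq: "(norm (fourier g \<xi> * cnj (\<Psi> (a * \<xi>))))\<^sup>2
            = (2 * pi * \<bar>B\<bar> * a) * ((norm (fourier g \<xi>))\<^sup>2 * (1 / a * (norm (S a (a * (p + B * \<xi>))))\<^sup>2))"
          using a by (simp add: norm_mult power_mult_distrib norm_\<Psi> arg)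
        show "ennreal ((norm (fourier g \<xi> * cnj (\<Psi> (a * \<xi>))))\<^sup>2)
            = ennreal (2 * pi * \<bar>B\<bar> * a) * (ennreal ((norm (fourier g \<xi>))\<^sup>2) *
              (ennreal (1 / a * (norm (S a (a * (p + B * \<xi>))))\<^sup>2) * indicator {0<..} a))"
          unfolding eq using a by (subst ennreal_mult3) simp_all
      qed
      also have "\<dots> = ennreal (2 * pi * \<bar>B\<bar> * a) * Q a"
        unfolding Q_def by (rule nn_integral_cmult[OF m])
      finally show ?thesis .
    qed
    have "?I < \<infinity>"
      unfolding I using fin by (simp add: ennreal_mult_less_top less_top)
    then have corr: "(\<integral>\<^sup>+b. ennreal ((norm (?corr b))\<^sup>2) \<partial>lborel) = ennreal (a\<^sup>2 / (2 * pi)) * ?I"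
      by (rule correlation_Plancherel[OF \<Psi> g a])
    have corr_meas: "(\<lambda>b. ennreal ((norm (?corr b))\<^sup>2)) \<in> borel_measurable lborel"
      using square_integrable_measurable[OF \<psi>] by measurable
    have "(\<integral>\<^sup>+b. ennreal ((norm (LINT t|lborel. f t * cnj (SA_frame ?M \<psi> (b, a) t)))\<^sup>2) \<partial>lborel)
        = (\<integral>\<^sup>+b. ennreal (1 / (2 * pi * a * \<bar>B\<bar>)) * ennreal ((norm (?corr b))\<^sup>2) \<partial>lborel)"
      unfolding SA_frame_def fst_conv snd_conv SAWT_norm[OF a] g_def
      using a by (intro nn_integral_cong ennreal_mult) auto
    also have "\<dots> = ennreal (1 / (2 * pi * a * \<bar>B\<bar>)) * (ennreal (a\<^sup>2 / (2 * pi)) * (ennreal (2 * pi * \<bar>B\<bar> * a) * Q a))"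
      unfolding nn_integral_cmult[OF corr_meas] corr I ..
    finally have "ennreal (1 / a\<^sup>2) * (\<integral>\<^sup>+b. ennreal ((norm (LINT t|lborel. f t * cnj (SA_frame ?M \<psi> (b, a) t)))\<^sup>2) \<partial>lborel)
        = ennreal (1 / a\<^sup>2) * (ennreal (1 / (2 * pi * a * \<bar>B\<bar>)) * (ennreal (a\<^sup>2 / (2 * pi)) * (ennreal (2 * pi * \<bar>B\<bar> * a) * Q a)))"
      by simp
    also have "\<dots> = ennreal (1 / a\<^sup>2 * (1 / (2 * pi * a * \<bar>B\<bar>) * (a\<^sup>2 / (2 * pi) * (2 * pi * \<bar>B\<bar> * a)))) * Q a"
    proof -
      have "ennreal u * (ennreal v * (ennreal w * (ennreal x * y))) = ennreal (u * (v * (w * x))) * y"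
        if "0 \<le> u" "0 \<le> v" "0 \<le> w" "0 \<le> x" for u v w x :: real and y :: ennreal
        using that by (simp add: ennreal_mult mult.assoc)
      then show ?thesis using a by simp
    qed
    also have "1 / a\<^sup>2 * (1 / (2 * pi * a * \<bar>B\<bar>) * (a\<^sup>2 / (2 * pi) * (2 * pi * \<bar>B\<bar> * a))) = 1 / (2 * pi)"
      using a B by (simp add: field_simps)
    finally show ?thesis .
  qed

  have coef_meas: "(\<lambda>x. ennreal ((norm (LINT t|lborel. f t * cnj (SA_frame ?M \<psi> x t)))\<^sup>2)) \<in> borel_measurable borel"
  proof -
    note [measurable] = SA_frame_measurable[of \<psi> A B C D p q]
    have "(\<lambda>(x, t). f t * cnj (SA_frame ?M \<psi> x t)) \<in> borel_measurable (half_plane_measure \<Otimes>\<^sub>M lborel)"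
      using square_integrable_measurable[OF \<psi>] by measurable
    from lborel.borel_measurable_lebesgue_integral[OF this]
    have [measurable]: "(\<lambda>x. LINT t|lborel. f t * cnj (SA_frame ?M \<psi> x t)) \<in> borel_measurable borel"
      by (simp cong: measurable_cong_sets)
    show ?thesis by measurable
  qed
  have "(\<integral>\<^sup>+x. ennreal ((norm (LINT t|lborel. f t * cnj (SA_frame ?M \<psi> x t)))\<^sup>2) \<partial>half_plane_measure)
      = (\<integral>\<^sup>+a\<in>{0<..}. ennreal (1 / a\<^sup>2) *
          (\<integral>\<^sup>+b. ennreal ((norm (LINT t|lborel. f t * cnj (SA_frame ?M \<psi> (b, a) t)))\<^sup>2) \<partial>lborel) \<partial>lborel)"
    by (rule nn_integral_half_plane_measure[OF coef_meas])
  also have "\<dots> = (\<integral>\<^sup>+a. ennreal (1 / (2 * pi)) * Q a \<partial>lborel)"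
  proof (rule nn_integral_cong_AE)
    show "AE a in lborel. ennreal (1 / a\<^sup>2) *
          (\<integral>\<^sup>+b. ennreal ((norm (LINT t|lborel. f t * cnj (SA_frame ?M \<psi> (b, a) t)))\<^sup>2) \<partial>lborel) * indicator {0<..} a
        = ennreal (1 / (2 * pi)) * Q a"
      using Q_finite
    proof eventually_elim
      case (elim a)
      show ?case
      proof (cases "a > 0")
        case True
        then show ?thesis using slice[OF True elim] by simp
      next
        case False
        then show ?thesis by (simp add: Q_def)
      qed
    qed
  qed
  also have "\<dots> = ennreal (1 / (2 * pi)) * (\<integral>\<^sup>+a. Q a \<partial>lborel)"
    using Q_meas by (intro nn_integral_cmult) simp
  also have "\<dots> = (ennreal (1 / (2 * pi)) * ennreal (2 * pi)) * (ennreal c * (\<integral>\<^sup>+t. ennreal ((norm (f t))\<^sup>2) \<partial>lborel))"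
    unfolding Q_total by (simp only: mult.assoc)
  also have "ennreal (1 / (2 * pi)) * ennreal (2 * pi) = ennreal (1 / (2 * pi) * (2 * pi))"
    by (rule ennreal_mult[symmetric]) auto
  finally show ?thesis by simp
qed

lemma SA_frame_tight:
  assumes "B \<noteq> 0" and \<psi>: "square_integrable lborel \<psi>"
    and "admissibility_constant (A, B, C, D, p, q) \<psi> c"
  shows "tight_frame half_plane_measure (SA_frame (A, B, C, D, p, q) \<psi>) c"
proof (intro tight_frame.intro tight_frame_axioms.intro)
  show "case_prod (SA_frame (A, B, C, D, p, q) \<psi>) \<in> borel_measurable (half_plane_measure \<Otimes>\<^sub>M lborel)"
    using square_integrable_measurable[OF \<psi>] by (intro SA_frame_measurable) simp
  show "0 \<le> c"
    using assms(3) by (simp add: admissibility_constant_def)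
qed (rule sigma_finite_half_plane_measure SA_frame_square_integrable[OF \<psi>] SAWT_isometry[OF assms]; assumption)+

text \<open>Integrated over \<open>b\<close>, the energy of the wavelets at a fixed point \<open>t\<close> is the same for every
  scale: the dilation contributes a factor \<open>a\<close>, which the normalization removes. Over \<open>a \<ge> \<delta>\<close> the
  weight \<open>1 / a\<^sup>2\<close> has integral \<open>1 / \<delta>\<close>.\<close>

lemma SA_frame_energy_away_from_zero:
  assumes \<psi>: "square_integrable lborel \<psi>" and \<delta>: "\<delta> > 0"
    and E: "E \<in> sets borel" "E \<subseteq> UNIV \<times> {\<delta>..}"
  shows "(\<integral>\<^sup>+x\<in>E. ennreal ((norm (SA_frame (A, B, C, D, p, q) \<psi> x t))\<^sup>2) \<partial>half_plane_measure)
      \<le> ennreal ((LINT s|lborel. (norm (\<psi> s))\<^sup>2) / (2 * pi * \<bar>B\<bar>) * (1 / \<delta>))"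
proof -
  let ?M = "(A, B, C, D, p, q)"
  let ?K = "(LINT s|lborel. (norm (\<psi> s))\<^sup>2) / (2 * pi * \<bar>B\<bar>)"
  note [measurable] = square_integrable_measurable[OF \<psi>] E(1)
  have K: "0 \<le> ?K" by (simp add: integral_nonneg_AE)
  have [measurable]: "SA_frame ?M \<psi> x \<in> borel_measurable borel" for x
    using square_integrable_measurable[OF SA_frame_square_integrable[OF \<psi>]] by simp
  have sec [measurable]: "(\<lambda>x. SA_frame ?M \<psi> x t) \<in> borel_measurable borel"
  proof -
    have "(\<lambda>x. (x, t)) \<in> half_plane_measure \<rightarrow>\<^sub>M half_plane_measure \<Otimes>\<^sub>M lborel" by measurable
    from measurable_compose[OF this SA_frame_measurable[of \<psi> A B C D p q]] show ?thesis
      by (simp cong: measurable_cong_sets)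
  qed
  have slice: "(\<integral>\<^sup>+b. ennreal ((norm (SA_frame ?M \<psi> (b, a) t))\<^sup>2) \<partial>lborel) = ennreal ?K" if a: "a > 0" for a
  proof -
    have "(\<integral>\<^sup>+b. ennreal ((norm (SA_frame ?M \<psi> (b, a) t))\<^sup>2) \<partial>lborel)
        = (\<integral>\<^sup>+b. ennreal (1 / (2 * pi * a * \<bar>B\<bar>)) * ennreal ((norm (\<psi> ((t - b) / a)))\<^sup>2) \<partial>lborel)"
      unfolding SA_frame_def fst_conv snd_conv SA_wavelet_norm[OF a]
      using a by (intro nn_integral_cong ennreal_mult) auto
    also have "\<dots> = ennreal (1 / (2 * pi * a * \<bar>B\<bar>)) * (\<integral>\<^sup>+b. ennreal ((norm (\<psi> ((t - b) / a)))\<^sup>2) \<partial>lborel)"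
      by (rule nn_integral_cmult) measurable
    also have "(\<integral>\<^sup>+b. ennreal ((norm (\<psi> ((t - b) / a)))\<^sup>2) \<partial>lborel)
        = ennreal a * (\<integral>\<^sup>+s. ennreal ((norm (\<psi> s))\<^sup>2) \<partial>lborel)"
      using nn_integral_real_affine[of "\<lambda>b. ennreal ((norm (\<psi> ((t - b) / a)))\<^sup>2)" "- a" t] a by simp
    also have "ennreal (1 / (2 * pi * a * \<bar>B\<bar>)) * (ennreal a * (\<integral>\<^sup>+s. ennreal ((norm (\<psi> s))\<^sup>2) \<partial>lborel))
        = ennreal (1 / (2 * pi * a * \<bar>B\<bar>) * (a * (LINT s|lborel. (norm (\<psi> s))\<^sup>2)))"
      unfolding nn_integral_square[OF \<psi>] using a
      by (simp only: ennreal_mult'[symmetric] ennreal_mult''[symmetric] integral_nonneg_AE) (auto simp: integral_nonneg_AE simp flip: ennreal_mult)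
    also have "1 / (2 * pi * a * \<bar>B\<bar>) * (a * (LINT s|lborel. (norm (\<psi> s))\<^sup>2)) = ?K"
      using a by simp
    finally show ?thesis .
  qed
  have "(\<integral>\<^sup>+x\<in>E. ennreal ((norm (SA_frame ?M \<psi> x t))\<^sup>2) \<partial>half_plane_measure)
      = (\<integral>\<^sup>+a\<in>{0<..}. ennreal (1 / a\<^sup>2) *
          (\<integral>\<^sup>+b. ennreal ((norm (SA_frame ?M \<psi> (b, a) t))\<^sup>2) * indicator E (b, a) \<partial>lborel) \<partial>lborel)"
    by (rule nn_integral_half_plane_measure) measurable
  also have "\<dots> \<le> (\<integral>\<^sup>+a. ennreal ?K * (ennreal (1 / a\<^sup>2) * indicator {\<delta>..} a) \<partial>lborel)"
  proof (rule nn_integral_mono)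
    fix a :: real
    show "ennreal (1 / a\<^sup>2) * (\<integral>\<^sup>+b. ennreal ((norm (SA_frame ?M \<psi> (b, a) t))\<^sup>2) * indicator E (b, a) \<partial>lborel) * indicator {0<..} a
        \<le> ennreal ?K * (ennreal (1 / a\<^sup>2) * indicator {\<delta>..} a)"
    proof (cases "\<delta> \<le> a")
      case True
      have "(\<integral>\<^sup>+b. ennreal ((norm (SA_frame ?M \<psi> (b, a) t))\<^sup>2) * indicator E (b, a) \<partial>lborel)
          \<le> (\<integral>\<^sup>+b. ennreal ((norm (SA_frame ?M \<psi> (b, a) t))\<^sup>2) \<partial>lborel)"
        by (intro nn_integral_mono) (auto simp: indicator_def)
      also have "\<dots> = ennreal ?K"
        using True \<delta> by (intro slice) simp
      finally have "ennreal (1 / a\<^sup>2) * (\<integral>\<^sup>+b. ennreal ((norm (SA_frame ?M \<psi> (b, a) t))\<^sup>2) * indicator E (b, a) \<partial>lborel)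
          \<le> ennreal (1 / a\<^sup>2) * ennreal ?K"
        by (rule mult_left_mono) simp
      then show ?thesis
        using True \<delta> by (simp add: mult.commute)
    next
      case False
      then have "indicator E (b, a) = (0::ennreal)" for b
        using E(2) by (auto simp: indicator_def)
      then show ?thesis by simp
    qed
  qed
  also have "\<dots> = ennreal ?K * (\<integral>\<^sup>+a. ennreal (1 / a\<^sup>2) * indicator {\<delta>..} a \<partial>lborel)"
    by (rule nn_integral_cmult) measurable
  also have "(\<integral>\<^sup>+a. ennreal (1 / a\<^sup>2) * indicator {\<delta>..} a \<partial>lborel) = ennreal (0 - (- (1 / \<delta>)))"
  proof (rule nn_integral_FTC_atLeast)
    fix x assume "\<delta> \<le> x"
    then have "x \<noteq> 0" using \<delta> by simp
    then show "DERIV (\<lambda>a. - (1 / a)) x :> 1 / x\<^sup>2"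
      by (auto intro!: derivative_eq_intros simp: power2_eq_square)
  next
    have "((\<lambda>a::real. 1 / a) \<longlongrightarrow> 0) at_top"
      by (rule tendsto_divide_0[OF tendsto_const filterlim_at_top_imp_at_infinity[OF filterlim_ident]])
    then show "((\<lambda>a. - (1 / a)) \<longlongrightarrow> (0::real)) at_top"
      using tendsto_minus by fastforce
  qed auto
  finally show ?thesis
    using K \<delta> by (simp add: ennreal_mult[symmetric])
qed

section \<open>Reconstruction\<close>

text \<open>By Fatou's lemma the lower limit of \<open>|g n t - h t|\<^sup>2\<close> vanishes for almost every \<open>t\<close>; where
  \<open>g n t\<close> converges, this lower limit is the squared distance of the limit from \<open>h t\<close>.\<close>

lemma tendsto_L2_pointwise_limit:
  assumes "tendsto_L2 g h"
  shows "AE t in lborel. \<forall>L. (\<lambda>n. g n t) \<longlonglongrightarrow> L \<longrightarrow> L = h t"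
proof -
  have [measurable]: "\<And>n. g n \<in> borel_measurable lborel" "h \<in> borel_measurable lborel"
    and lim: "(\<lambda>n. \<integral>\<^sup>+t. ennreal ((norm (g n t - h t))\<^sup>2) \<partial>lborel) \<longlonglongrightarrow> 0"
    using assms by (auto simp: tendsto_L2_def)
  have "(\<integral>\<^sup>+t. liminf (\<lambda>n. ennreal ((norm (g n t - h t))\<^sup>2)) \<partial>lborel)
      \<le> liminf (\<lambda>n. \<integral>\<^sup>+t. ennreal ((norm (g n t - h t))\<^sup>2) \<partial>lborel)"
    by (rule nn_integral_liminf) measurable
  also have "\<dots> = 0"
    by (rule lim_imp_Liminf[OF _ lim]) simp
  finally have "(\<integral>\<^sup>+t. liminf (\<lambda>n. ennreal ((norm (g n t - h t))\<^sup>2)) \<partial>lborel) = 0"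
    by simp
  then have "AE t in lborel. liminf (\<lambda>n. ennreal ((norm (g n t - h t))\<^sup>2)) = 0"
    by (subst (asm) nn_integral_0_iff_AE) measurable
  then show ?thesis
  proof (eventually_elim, intro allI impI)
    fix t L
    assume z: "liminf (\<lambda>n. ennreal ((norm (g n t - h t))\<^sup>2)) = 0" and L: "(\<lambda>n. g n t) \<longlonglongrightarrow> L"
    have "(\<lambda>n. ennreal ((norm (g n t - h t))\<^sup>2)) \<longlonglongrightarrow> ennreal ((norm (L - h t))\<^sup>2)"
      by (intro tendsto_ennrealI tendsto_power tendsto_norm tendsto_diff L tendsto_const)
    from lim_imp_Liminf[OF _ this] z have "ennreal ((norm (L - h t))\<^sup>2) = 0" by simp
    then show "L = h t" by simp
  qed
qed

theorem theorem3p4: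
  fixes A B C D p q C\<^sub>\<psi> :: real and \<psi> f :: "real \<Rightarrow> complex" and M :: saft_params
  assumes "M = (A, B, C, D, p, q)"
    and "A * D - B * C = 1" and "B \<noteq> 0"
    and "L2 \<psi>" and "L2 f"
    and "admissibility_constant M \<psi> C\<^sub>\<psi>" and "C\<^sub>\<psi> \<noteq> 0"
  shows "\<exists>I. has_half_plane_integral_L2 (\<lambda>b a t. SAWT M \<psi> f b a * SA_wavelet M \<psi> b a t) I \<and>
             (AE t in lborel. f t = 1 / of_real C\<^sub>\<psi> * I t) \<and>
             (AE t in lborel.
                set_integrable lborel half_plane
                  (\<lambda>(b, a). SAWT M \<psi> f b a * SA_wavelet M \<psi> b a t / of_real (a\<^sup>2)) \<longrightarrow>
                f t = 1 / of_real C\<^sub>\<psi> *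
                  (LINT (b, a):half_plane|lborel.
                     SAWT M \<psi> f b a * SA_wavelet M \<psi> b a t / of_real (a\<^sup>2)))"
proof -
  have \<psi>: "square_integrable lborel \<psi>" and f: "square_integrable lborel f"
    using assms(4,5) by (simp_all add: L2_iff_square_integrable)
  have adm: "admissibility_constant (A, B, C, D, p, q) \<psi> C\<^sub>\<psi>"
    using assms(1,6) by simp
  interpret frame: tight_frame half_plane_measure "SA_frame (A, B, C, D, p, q) \<psi>" C\<^sub>\<psi>
    by (rule SA_frame_tight[OF assms(3) \<psi> adm])
  let ?F = "\<lambda>t x. frame.coef f x * SA_frame (A, B, C, D, p, q) \<psi> x t"
  let ?\<Phi> = "\<lambda>b a t. SAWT M \<psi> f b a * SA_wavelet M \<psi> b a t"
  define I where "I t = of_real C\<^sub>\<psi> * f t" for t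

  have \<Phi>: "(\<lambda>(b, a). ?\<Phi> b a t / of_real (a\<^sup>2)) = (\<lambda>x. ?F t x / of_real ((snd x)\<^sup>2))" for t
    by (simp add: fun_eq_iff SAWT_def frame.coef_def SA_frame_def assms(1))
  have coef_meas: "frame.coef f \<in> borel_measurable borel"
    using frame.coef_measurable[OF f] by (simp cong: measurable_cong_sets)
  have I: "L2 I"
    unfolding I_def[abs_def] L2_iff_square_integrable by (rule square_integrable_cmult[OF f])

  have limit: "(\<forall>n t. set_integrable lborel (E n) (\<lambda>(b, a). ?\<Phi> b a t / of_real (a\<^sup>2))) \<and>
      tendsto_L2 (\<lambda>n t. LINT (b, a):E n|lborel. ?\<Phi> b a t / of_real (a\<^sup>2)) I"
    if E: "half_plane_exhaustion E" for E
  proof -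
    have E_borel [measurable]: "E n \<in> sets borel" and E_sub: "E n \<subseteq> half_plane" for n
      using E unfolding half_plane_exhaustion_def by auto
    have E_sets: "E n \<in> sets half_plane_measure" for n by simp
    have "\<exists>K. \<forall>t. (\<integral>\<^sup>+x\<in>E n. ennreal ((norm (SA_frame (A, B, C, D, p, q) \<psi> x t))\<^sup>2) \<partial>half_plane_measure) \<le> ennreal K" for n
    proof -
      obtain \<delta> where "\<delta> > 0" "E n \<subseteq> UNIV \<times> {\<delta>..}"
        using E unfolding half_plane_exhaustion_def by blast
      from SA_frame_energy_away_from_zero[OF \<psi> this(1) E_borel this(2)] show ?thesis by blast
    qed
    then have "\<exists>K. \<forall>n t. (\<integral>\<^sup>+x\<in>E n. ennreal ((norm (SA_frame (A, B, C, D, p, q) \<psi> x t))\<^sup>2) \<partial>half_plane_measure)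
        \<le> ennreal (K n)"
      by (intro choice allI)
    then obtain K where K: "\<And>n t. (\<integral>\<^sup>+x\<in>E n. ennreal ((norm (SA_frame (A, B, C, D, p, q) \<psi> x t))\<^sup>2) \<partial>half_plane_measure)
        \<le> ennreal (K n)"
      by blast
    have F_meas: "?F t \<in> borel_measurable borel" for t
      using coef_meas frame.frame_section_measurable[of t] by (simp cong: measurable_cong_sets)
    have syn: "(LINT (b, a):E n|lborel. ?\<Phi> b a t / of_real (a\<^sup>2)) = frame.partial_synthesis (E n) f t" for n t
      unfolding \<Phi> frame.partial_synthesis_def
      by (rule set_integral_half_plane_measure[OF F_meas E_borel E_sub, symmetric])
    have int: "set_integrable lborel (E n) (\<lambda>(b, a). ?\<Phi> b a t / of_real (a\<^sup>2))" for n t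
      unfolding \<Phi>
      by (rule set_integrable_half_plane_measure[OF F_meas E_borel E_sub, THEN iffD1,
            OF frame.partial_synthesis_set_integrable[OF E_sets K f]])
    \<comment> \<open>The exhaustion covers the half plane, so the energy of the coefficients outside \<open>E n\<close> tends to \<open>0\<close>.\<close>
    have tail: "(\<lambda>n. LINT x|half_plane_measure. (norm (indicator (- E n) x *\<^sub>R frame.coef f x))\<^sup>2)
        \<longlonglongrightarrow> integral\<^sup>L half_plane_measure (\<lambda>x::real \<times> real. 0::real)"
    proof (rule integral_dominated_convergence[where w="\<lambda>x. (norm (frame.coef f x))\<^sup>2"])
      show "AE x in half_plane_measure. (\<lambda>n. (norm (indicator (- E n) x *\<^sub>R frame.coef f x))\<^sup>2) \<longlonglongrightarrow> 0"
        using half_plane_measure_AE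
      proof eventually_elim
        case (elim x)
        then have "x \<in> (\<Union>n. E n)"
          using E by (simp add: half_plane_exhaustion_def)
        then obtain m where "x \<in> E m" by blast
        then have "x \<in> E n" if "n \<ge> m" for n
          using E that unfolding half_plane_exhaustion_def incseq_def by blast
        then show ?case
          by (intro tendsto_eventually eventually_sequentiallyI[of m]) simp
      qed
      show "AE x in half_plane_measure. norm ((norm (indicator (- E n) x *\<^sub>R frame.coef f x))\<^sup>2)
          \<le> (norm (frame.coef f x))\<^sup>2" for n
        by (auto simp: indicator_def)
      show "(\<lambda>x. (norm (indicator (- E n) x *\<^sub>R frame.coef f x))\<^sup>2) \<in> borel_measurable half_plane_measure" for n
        using coef_meas by measurable
    qed (use square_integrable_integrable[OF frame.square_integrable_coef[OF f]] in auto)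
    have "tendsto_L2 (\<lambda>n. frame.partial_synthesis (E n) f) I"
      unfolding tendsto_L2_def
    proof (intro conjI allI)
      show "frame.partial_synthesis (E n) f \<in> borel_measurable lborel" for n
        by (rule frame.partial_synthesis_measurable[OF E_sets K f])
      show "I \<in> borel_measurable lborel"
        using I by (simp add: L2_def)
      have lim: "(\<lambda>n. ennreal (C\<^sub>\<psi> * (LINT x|half_plane_measure. (norm (indicator (- E n) x *\<^sub>R frame.coef f x))\<^sup>2)))
          \<longlonglongrightarrow> ennreal (C\<^sub>\<psi> * 0)"
        using tail by (intro tendsto_ennrealI tendsto_mult_left) simp
      have le: "(\<integral>\<^sup>+t. ennreal ((norm (frame.partial_synthesis (E n) f t - I t))\<^sup>2) \<partial>lborel)
          \<le> ennreal (C\<^sub>\<psi> * (LINT x|half_plane_measure. (norm (indicator (- E n) x *\<^sub>R frame.coef f x))\<^sup>2))" for n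
        using frame.partial_synthesis_error[OF E_sets K f, of n]
        by (simp add: I_def norm_minus_commute)
      show "(\<lambda>n. \<integral>\<^sup>+t. ennreal ((norm (frame.partial_synthesis (E n) f t - I t))\<^sup>2) \<partial>lborel) \<longlonglongrightarrow> 0"
        by (rule tendsto_sandwich[OF always_eventually always_eventually tendsto_const
              lim[unfolded mult_zero_right ennreal_0]])
           (simp, rule allI, rule le)
    qed
    then show ?thesis
      unfolding syn using int by blast
  qed

  \<comment> \<open>One concrete exhaustion suffices to identify the absolutely convergent integrals.\<close>
  define E0 where "E0 n = (UNIV :: real set) \<times> {1 / real (Suc n)..}" for n
  have E0: "half_plane_exhaustion E0"
    unfolding half_plane_exhaustion_def
  proof (intro conjI allI)
    show "incseq E0"
      unfolding E0_def incseq_def by (auto simp: frac_le intro: order_trans[rotated])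
    show "E0 n \<in> sets borel" for n
      unfolding E0_def by (intro borel_closed closed_Times) auto
    show "\<exists>\<delta>>0. E0 n \<subseteq> UNIV \<times> {\<delta>..}" for n
      unfolding E0_def by (intro exI[of _ "1 / real (Suc n)"]) auto
    show "(\<Union>n. E0 n) = half_plane"
    proof (intro equalityI subsetI)
      fix x assume "x \<in> half_plane"
      then obtain n where "1 / real (Suc n) < snd x"
        using nat_approx_posE[of "snd x"] by (auto simp: half_plane_iff)
      then have "x \<in> E0 n"
        by (simp add: E0_def mem_Times_iff)
      then show "x \<in> (\<Union>n. E0 n)" by blast
    next
      fix x assume "x \<in> (\<Union>n. E0 n)"
      then obtain n where "1 / real (Suc n) \<le> snd x" by (auto simp: E0_def)
      then have "0 < snd x" by (rule less_le_trans[rotated]) simp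
      then show "x \<in> half_plane" by (simp add: half_plane_iff)
    qed
  qed
  have absolute: "AE t in lborel. set_integrable lborel half_plane (\<lambda>(b, a). ?\<Phi> b a t / of_real (a\<^sup>2)) \<longrightarrow>
      f t = 1 / of_real C\<^sub>\<psi> * (LINT (b, a):half_plane|lborel. ?\<Phi> b a t / of_real (a\<^sup>2))"
    using tendsto_L2_pointwise_limit[OF conjunct2[OF limit[OF E0]]]
  proof (eventually_elim, intro impI)
    fix t
    assume unique: "\<forall>L. (\<lambda>n. LINT (b, a):E0 n|lborel. ?\<Phi> b a t / of_real (a\<^sup>2)) \<longlonglongrightarrow> L \<longrightarrow> L = I t"
      and int: "set_integrable lborel half_plane (\<lambda>(b, a). ?\<Phi> b a t / of_real (a\<^sup>2))"
    have UN: "(\<Union>n. E0 n) = half_plane"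
      using E0 by (simp add: half_plane_exhaustion_def)
    have "(\<lambda>n. LINT (b, a):E0 n|lborel. ?\<Phi> b a t / of_real (a\<^sup>2))
        \<longlonglongrightarrow> (LINT (b, a):(\<Union>n. E0 n)|lborel. ?\<Phi> b a t / of_real (a\<^sup>2))"
      by (rule set_integral_cont_up) (use E0 int UN in \<open>auto simp: half_plane_exhaustion_def\<close>)
    with unique have "(LINT (b, a):half_plane|lborel. ?\<Phi> b a t / of_real (a\<^sup>2)) = I t"
      unfolding UN by blast
    then show "f t = 1 / of_real C\<^sub>\<psi> * (LINT (b, a):half_plane|lborel. ?\<Phi> b a t / of_real (a\<^sup>2))"
      using assms(7) by (simp add: I_def)
  qed
  have "has_half_plane_integral_L2 ?\<Phi> I"
    unfolding has_half_plane_integral_L2_def using I limit by blast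
  moreover have "AE t in lborel. f t = 1 / of_real C\<^sub>\<psi> * I t"
    using assms(7) by (simp add: I_def)
  ultimately show ?thesis
    using absolute by blast
qed

end
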